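(* Let $\mathbf H=(h_{ij})_{i,j\ge1}$ be a sub-stochastic matrix, $\mathbf g=(g_1,g_2,\ldots)$ a probability distribution on $\{1,2,\ldots\}$, $m>0$ a constant, and $$\mathbf M=\mathbf H+m\mathbf H\mathbf 1^{\mathrm t}\mathbf g .$$ Let $d_n$, $f$, $R_f$, $\alpha$, $\beta$ be defined from $(\mathbf H,\mathbf g,m)$ as in the context. The matrix $\mathbf M$ is irreducible if and only if there are no phantom types and $\mathbf H$ does not contain zero rows. If $\mathbf M$ is irreducible and aperiodic, then the following three statements are valid: (i) the convergence parameter $R$ of $\mathbf M$ is $$R=\begin{cases}e^{-\alpha}, & \text{if }\alpha>-\infty,\\ R_f, & \text{if }\alpha=-\infty;\end{cases}$$ (ii) $\mathbf M$ is $R$-recurrent if and only if $\alpha>-\infty$; (iii) $\mathbf M$ is $R$-positively recurrent if and only if $\beta<\infty$. In the latter case (that is, if $\mathbf M$ is irreducible and aperiodic and $\beta<\infty$), $$R^n\mathbf M^n\to\mathbf u^{\mathrm t}\mathbf v,\qquad n\to\infty,$$ element-wise, where the element-wise positive and finite vectors $\mathbf u$ and $\mathbf v$ are given by $$\mathbf u^{\mathrm t}=(1+m)\beta^{-1}\sum_{k=1}^\infty R^k\mathbf H^k\mathbf 1^{\mathrm t},\qquad \mathbf v=\frac{m}{1+m}\sum_{k=0}^\infty R^k\mathbf g\mathbf H^k,$$ and satisfy $\mathbf v\mathbf u^{\mathrm t}=\mathbf v\mathbf 1^{\mathrm t}=1$ as well as $\mathbf g\mathbf u^{\mathrm t}=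\frac{1+m}{m\beta}$.
   Context: Vectors are row vectors indexed by $\{1,2,\ldots\}$; $\mathbf x^{\mathrm t}$ denotes the transpose; $\mathbf 1=(1,1,\ldots)$. A sub-stochastic matrix has non-negative entries and all row sums at most $1$. ($\mathbf M$ is the matrix of mean offspring numbers of the linear-fractional multi-type Bienaym\'e-Galton-Watson process with parameters $(\mathbf H,\mathbf g,m)$.) Phantom type: $j\ge1$ is a phantom type if the $j$-th element of $\mathbf g\mathbf H^n$ is zero for all $n\ge0$. Quantities of the associated Crump-Mode-Jagers process: $d_n=\mathbf g\mathbf H^n\mathbf 1^{\mathrm t}$ for $n\ge1$; $f(s)=\sum_{n\ge1}d_ns^n\in[0,\infty]$ for $s\ge0$; $R_f=\inf\{s>0:f(s)=\infty\}$ (with $\inf\emptyset=\infty$, and $f(\infty)=\lim_{s\to\infty}f(s)$). The Malthusian parameter $\alpha$: if $f(R_f)\ge1/m$, then $\alpha$ is the unique real solution of $mf(e^{-\alpha})=1$; if $f(R_f)<1/m$, then $\alpha=-\infty$. The mean age at childbearing: $\beta=m\sum_{n\ge1}nd_ne^{-\alpha n}$ if $\alpha>-\infty$, and $\beta=\infty$ if $\alpha=-\infty$. Countable non-negative matrices: write $\mathbf M^n=(m_{ij}^{(n)})_{i,j\ge1}$. $\mathbf M$ is irreducible if for every $(i,j)$ there is a natural number $n\ge1$ with $m_{ij}^{(n)}>0$; its period is the greatest common divisor of $\{n\ge1:m_{ii}^{(n)}>0\}$ (independent of $i$), and $\mathbf M$ is aperiodic if the period is $1$. For irreducible aperiodic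 $\mathbf M$ all the power series $\sum_{n\ge0}m_{ij}^{(n)}s^n$ have a common radius of convergence $R$, called the convergence parameter of $\mathbf M$. $\mathbf M$ is $R$-transient if $\sum_nm_{ii}^{(n)}R^n<\infty$ for all $i\ge1$, and $R$-recurrent if $\sum_nm_{ii}^{(n)}R^n=\infty$ for all $i\ge1$ (exactly one of the two holds). In the $R$-recurrent case there are positive vectors $\mathbf x,\mathbf y$, unique up to constant multipliers, with $R\mathbf M\mathbf x^{\mathrm t}=\mathbf x^{\mathrm t}$ and $R\mathbf y\mathbf M=\mathbf y$; an $R$-recurrent $\mathbf M$ is called $R$-positively recurrent if $\mathbf y\mathbf x^{\mathrm t}<\infty$ and $R$-null recurrent if $\mathbf y\mathbf x^{\mathrm t}=\infty$. *)

theory Defs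
  imports "HOL-Analysis.Analysis"
begin

text \<open>
  Vectors and matrices have entries in \<open>[0,\<infinity>]\<close>, so every infinite sum below is meaningful without
  side conditions; finiteness is stated explicitly where it matters. The countable index set
  \<open>{1,2,\<dots>}\<close> is relabelled as \<^typ>\<open>nat\<close>, with \<open>j\<close> standing for type \<open>j + 1\<close>; only the index set
  as a set matters, not its arithmetic.
\<close>

type_synonym nnvec = "nat \<Rightarrow> ennreal"
type_synonym nnmat = "nat \<Rightarrow> nat \<Rightarrow> ennreal"

definition dotp :: "nnvec \<Rightarrow> nnvec \<Rightarrow> ennreal" where
  "dotp x y = (\<Sum>i. x i * y i)"

definition mat_vec :: "nnmat \<Rightarrow> nnvec \<Rightarrow> nnvec" where
  "mat_vec A x = (\<lambda>i. \<Sum>k. A i k * x k)"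

definition vec_mat :: "nnvec \<Rightarrow> nnmat \<Rightarrow> nnvec" where
  "vec_mat x A = (\<lambda>j. \<Sum>k. x k * A k j)"

definition mat_mult :: "nnmat \<Rightarrow> nnmat \<Rightarrow> nnmat" where
  "mat_mult A B = (\<lambda>i j. \<Sum>k. A i k * B k j)"

definition id_mat :: nnmat where
  "id_mat = (\<lambda>i j. if i = j then 1 else 0)"

primrec mat_pow :: "nnmat \<Rightarrow> nat \<Rightarrow> nnmat" where
  "mat_pow A 0 = id_mat"
| "mat_pow A (Suc n) = mat_mult (mat_pow A n) A"

definition ones :: nnvec where
  "ones = (\<lambda>_. 1)"

definition sub_stochastic :: "nnmat \<Rightarrow> bool" where
  "sub_stochastic A \<longleftrightarrow> (\<forall>i. (\<Sum>j. A i j) \<le> 1)"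

definition prob_vec :: "nnvec \<Rightarrow> bool" where
  "prob_vec g \<longleftrightarrow> (\<Sum>j. g j) = 1"

definition mean_matrix :: "nnmat \<Rightarrow> nnvec \<Rightarrow> real \<Rightarrow> nnmat" where
  "mean_matrix H g m = (\<lambda>i j. H i j + ennreal m * mat_vec H ones i * g j)"

definition phantom_type :: "nnmat \<Rightarrow> nnvec \<Rightarrow> nat \<Rightarrow> bool" where
  "phantom_type H g j \<longleftrightarrow> (\<forall>n. vec_mat g (mat_pow H n) j = 0)"

definition zero_row :: "nnmat \<Rightarrow> nat \<Rightarrow> bool" where
  "zero_row A i \<longleftrightarrow> (\<forall>j. A i j = 0)"


subsection \<open>The associated Crump-Mode-Jagers process\<close>

definition cmj_d :: "nnmat \<Rightarrow> nnvec \<Rightarrow> nat \<Rightarrow> ennreal" where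
  "cmj_d H g n = dotp (vec_mat g (mat_pow H n)) ones"

text \<open>Intended for \<open>s \<ge> 0\<close> only (\<^const>\<open>ennreal\<close> sends negative reals to 0).\<close>

definition cmj_f :: "nnmat \<Rightarrow> nnvec \<Rightarrow> real \<Rightarrow> ennreal" where
  "cmj_f H g s = (\<Sum>n. cmj_d H g (Suc n) * ennreal s ^ Suc n)"

definition cmj_Rf :: "nnmat \<Rightarrow> nnvec \<Rightarrow> ereal" where
  "cmj_Rf H g = Inf (ereal ` {s. 0 < s \<and> cmj_f H g s = \<infinity>})"

definition cmj_f_at_Rf :: "nnmat \<Rightarrow> nnvec \<Rightarrow> ennreal" where
  "cmj_f_at_Rf H g =
    (if cmj_Rf H g = \<infinity> then Lim at_top (cmj_f H g)
     else cmj_f H g (real_of_ereal (cmj_Rf H g)))"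

definition malthusian :: "nnmat \<Rightarrow> nnvec \<Rightarrow> real \<Rightarrow> ereal" where
  "malthusian H g m =
    (if cmj_f_at_Rf H g \<ge> ennreal (1 / m)
     then ereal (THE a. ennreal m * cmj_f H g (exp (- a)) = 1)
     else -\<infinity>)"

definition mean_age :: "nnmat \<Rightarrow> nnvec \<Rightarrow> real \<Rightarrow> ennreal" where
  "mean_age H g m =
    (if malthusian H g m > -\<infinity>
     then ennreal m * (\<Sum>n. of_nat (Suc n) * cmj_d H g (Suc n) *
            ennreal (exp (- real_of_ereal (malthusian H g m) * real (Suc n))))
     else \<infinity>)"


subsection \<open>Countable non-negative matrices\<close>

definition mat_irreducible :: "nnmat \<Rightarrow> bool" where
  "mat_irreducible A \<longleftrightarrow> (\<forall>i j. \<exists>n\<ge>1. mat_pow A n i j > 0)"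

definition mat_period :: "nnmat \<Rightarrow> nat \<Rightarrow> nat" where
  "mat_period A i = Gcd {n. n \<ge> 1 \<and> mat_pow A n i i > 0}"

definition mat_aperiodic :: "nnmat \<Rightarrow> bool" where
  "mat_aperiodic A \<longleftrightarrow> (\<forall>i. mat_period A i = 1)"

text \<open>
  \<open>R\<close> is the common radius of convergence of all the series \<open>\<Sum>n. (A\<^sup>n)\<^sub>i\<^sub>j s\<^sup>n\<close>. The definition is
  meant for matrices all of whose powers have finite entries, such as \<^const>\<open>mean_matrix\<close>
  of a sub-stochastic matrix and a probability vector, where \<^const>\<open>enn2real\<close> loses nothing.
\<close>

definition is_convergence_parameter :: "nnmat \<Rightarrow> real \<Rightarrow> bool" where
  "is_convergence_parameter A R \<longleftrightarrow>
    (\<forall>i j. conv_radius (\<lambda>n. enn2real (mat_pow A n i j)) = ereal R)"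

definition R_recurrent :: "real \<Rightarrow> nnmat \<Rightarrow> bool" where
  "R_recurrent R A \<longleftrightarrow> (\<forall>i. (\<Sum>n. mat_pow A n i i * ennreal R ^ n) = \<infinity>)"

definition positive_vec :: "nnvec \<Rightarrow> bool" where
  "positive_vec x \<longleftrightarrow> (\<forall>i. 0 < x i \<and> x i < \<infinity>)"

text \<open>
  For an \<open>R\<close>-recurrent irreducible aperiodic matrix the eigenvectors \<open>x\<close> and \<open>y\<close> exist and are
  unique up to constant multipliers, so the finiteness of \<open>y x\<^sup>t\<close> does not depend on their choice.
\<close>

definition R_positively_recurrent :: "real \<Rightarrow> nnmat \<Rightarrow> bool" where
  "R_positively_recurrent R A \<longleftrightarrow>
    R_recurrent R A \<and>
    (\<exists>x y. positive_vec x \<and> positive_vec y \<and>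
      (\<forall>i. ennreal R * mat_vec A x i = x i) \<and>
      (\<forall>j. ennreal R * vec_mat y A j = y j) \<and>
      dotp y x < \<infinity>)"


subsection \<open>The limit vectors\<close>

definition lim_u :: "nnmat \<Rightarrow> nnvec \<Rightarrow> real \<Rightarrow> real \<Rightarrow> nnvec" where
  "lim_u H g m R = (\<lambda>i. ennreal (1 + m) * inverse (mean_age H g m) *
     (\<Sum>k. ennreal R ^ Suc k * mat_vec (mat_pow H (Suc k)) ones i))"

definition lim_v :: "nnmat \<Rightarrow> nnvec \<Rightarrow> real \<Rightarrow> real \<Rightarrow> nnvec" where
  "lim_v H g m R = (\<lambda>j. ennreal (m / (1 + m)) *
     (\<Sum>k. ennreal R ^ k * vec_mat g (mat_pow H k) j))"

end

theory Submission
  imports Defs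
begin

text \<open>
  Decomposing a path of \<open>M\<close> at the factors \<open>m H 1\<^sup>t g\<close> gives
  \<open>M\<^sup>n = H\<^sup>n + m \<Sum> (H\<^sup>k 1\<^sup>t) u\<^sub>r (g H\<^sup>l)\<close>, summed over \<open>k + r + l = n\<close> with \<open>k \<ge> 1\<close>, where
  \<open>u\<close> is the renewal sequence with increment weights \<open>m d\<^sub>n\<close>. Hence the generating function of
  \<open>u\<close> is \<open>1 / (1 - m f(s))\<close>, and every entry of \<open>\<Sum> M\<^sup>n s\<^sup>n\<close> is finite exactly
  when \<open>m f(s) < 1\<close>. This gives the convergence parameter and the recurrence criterion.
  At \<open>m f(R) = 1\<close> the generating functions of \<open>H\<^sup>k 1\<^sup>t\<close> and \<open>g H\<^sup>l\<close> are the two eigenvectors,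
  they are minimal among all eigenvectors up to scaling, and their product is \<open>\<beta> / m\<close>.
  The limit of \<open>R\<^sup>n M\<^sup>n\<close> follows from the renewal theorem for the weights \<open>m d\<^sub>n R\<^sup>n\<close>; since
  \<open>H\<close> has no zero rows, all \<open>d\<^sub>n\<close> are positive, so these weights are aperiodic.
\<close>

subsection \<open>The renewal theorem\<close>

text \<open>The least positive difference \<open>d\<close> of two elements of \<open>S\<close>
  divides every element, since a nonzero remainder would be a smaller difference; so
  \<open>d = 1\<close>. Two consecutive elements \<open>b\<close> and \<open>b + 1\<close> then
  generate everything from \<open>b * b\<close> on.\<close>

lemma numerical_semigroup_cofinite:
  fixes S :: "nat set"
  assumes zero: "0 \<in> S" and add: "\<And>a b. a \<in> S \<Longrightarrow> b \<in> S \<Longrightarrow> a + b \<in> S"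
    and gcd: "Gcd S = 1"
  obtains N where "\<And>n. n \<ge> N \<Longrightarrow> n \<in> S"
proof -
  have mult: "k * a \<in> S" if "a \<in> S" for a k
    by (induction k) (use that zero add in auto)
  define P where "P d \<longleftrightarrow> d > 0 \<and> (\<exists>b. b \<in> S \<and> b + d \<in> S)" for d
  obtain s where s: "s \<in> S" "s > 0"
  proof (cases "S \<subseteq> {0}")
    case True
    then have "S = {0}" using zero by auto
    then show ?thesis using gcd by simp
  qed (use that in auto)
  then have "P s" using zero by (auto simp: P_def)
  define d where "d = (LEAST d. P d)"
  have "P d" unfolding d_def by (rule LeastI) fact
  then obtain b where b: "d > 0" "b \<in> S" "b + d \<in> S" by (auto simp: P_def)
  have "d dvd t" if "t \<in> S" for t
  proof (rule ccontr)
    assume "\<not> d dvd t"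
    then have pos: "t mod d > 0" by (simp add: dvd_eq_mod_eq_0)
    have "(t div d) * b + t \<in> S" "(t div d) * (b + d) \<in> S"
      using add mult b that by auto
    moreover have "(t div d) * b + t = (t div d) * (b + d) + t mod d"
      using div_mult_mod_eq[of t d] by (simp add: distrib_left)
    ultimately have "P (t mod d)" using pos unfolding P_def by auto
    then have "d \<le> t mod d" unfolding d_def by (rule Least_le)
    then show False using mod_less_divisor[OF b(1), of t] by linarith
  qed
  then have "d dvd Gcd S" by (simp add: dvd_Gcd_iff)
  then have d1: "b + 1 \<in> S" using gcd b by auto
  have "n \<in> S" if "n \<ge> b * b" for n
  proof (cases "b = 0")
    case True
    then show ?thesis using mult[OF d1, of n] by simp
  next
    case False
    then have "n mod b < b" "b \<le> n div b" using div_le_mono[OF that, of b] by simp_all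
    then have "n mod b \<le> n div b" by linarith
    \<comment> \<open>With quotient \<open>q\<close>, remainder \<open>r\<close> and
      \<open>r \<le> q\<close>, the idea is \<open>n = (q - r) * b + r * (b + 1)\<close>.\<close>
    then obtain c where "n div b = n mod b + c" using le_Suc_ex by blast
    then have "n = (n mod b + c) * b + n mod b" using div_mult_mod_eq[of n b] by simp
    also have "\<dots> = c * b + (n mod b) * (b + 1)" by (simp add: algebra_simps)
    also have "\<dots> \<in> S" using add[OF mult[OF b(2)] mult[OF d1]] .
    finally show ?thesis .
  qed
  then show ?thesis using that by blast
qed

lemma suminf_truncated:
  fixes f :: "nat \<Rightarrow> 'a::{t2_space, comm_monoid_add}"
  shows "(\<Sum>k. if k \<le> n then f k else 0) = (\<Sum>k\<le>n. f k)"
  by (subst suminf_finite[of "{..n}"]) auto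

text \<open>Tannery's theorem with majorant \<open>\<bar>a k\<bar> * C\<close>. Only the shifts of
  \<open>b\<close> along \<open>N\<close> must converge, so it applies to subsequences of a
  \<open>b\<close> that is not yet known to converge.\<close>

lemma tendsto_convolution_filter:
  fixes a b :: "nat \<Rightarrow> real" and N :: "nat \<Rightarrow> nat"
  assumes a: "summable (\<lambda>k. \<bar>a k\<bar>)" and C: "\<And>n. \<bar>b n\<bar> \<le> C"
    and N: "filterlim N at_top sequentially"
    and b: "\<And>k. (\<lambda>n. b (N n - k)) \<longlonglongrightarrow> L"
  shows "(\<lambda>n. \<Sum>k\<le>N n. a k * b (N n - k)) \<longlonglongrightarrow> (\<Sum>k. a k) * L"
proof -
  let ?f = "\<lambda>k n. if k \<le> N n then a k * b (N n - k) else 0"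
  have "(\<lambda>n. \<Sum>k. ?f k n) \<longlonglongrightarrow> (\<Sum>k. a k * L)"
  proof (rule tannerys_theorem[THEN conjunct2, THEN conjunct2])
    fix k
    have "eventually (\<lambda>n. k \<le> N n) sequentially"
      using N by (simp add: filterlim_at_top)
    then have "eventually (\<lambda>n. a k * b (N n - k) = ?f k n) sequentially"
      by eventually_elim simp
    with tendsto_mult[OF tendsto_const[of "a k"] b[of k]]
    show "(\<lambda>n. ?f k n) \<longlonglongrightarrow> a k * L"
      by (rule Lim_transform_eventually)
  next
    have "C \<ge> 0" using C[of 0] by linarith
    then show "eventually (\<lambda>(k, n). norm (?f k n) \<le> \<bar>a k\<bar> * C) (at_top \<times>\<^sub>F sequentially)"
      by (intro always_eventually) (auto simp: abs_mult intro!: mult_left_mono C)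
    show "summable (\<lambda>k. \<bar>a k\<bar> * C)" using a by (rule summable_mult2)
  qed simp
  then show ?thesis
    by (simp add: suminf_truncated suminf_mult2[OF summable_rabs_cancel[OF a], symmetric])
qed

lemma tendsto_convolution:
  fixes a b :: "nat \<Rightarrow> real"
  assumes a: "summable (\<lambda>k. \<bar>a k\<bar>)" and b: "b \<longlonglongrightarrow> L"
  shows "(\<lambda>n. \<Sum>k\<le>n. a k * b (n - k)) \<longlonglongrightarrow> (\<Sum>k. a k) * L"
proof -
  obtain C where "\<And>n. \<bar>b n\<bar> \<le> C"
    using convergent_imp_Bseq[of b] b by (auto simp: convergent_def Bseq_def)
  moreover have "(\<lambda>n. b (n - k)) \<longlonglongrightarrow> L" for k
    using b by (simp add: LIMSEQ_offset[of "\<lambda>n. b (n - k)" k])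
  ultimately show ?thesis
    using tendsto_convolution_filter[OF a, of b C id L] by (simp add: filterlim_ident id_def)
qed

text \<open>\<open>l\<close> is the limit superior; the bound keeps it finite.\<close>

lemma bounded_limsup_subseq:
  fixes w :: "nat \<Rightarrow> real"
  assumes C: "\<And>n. \<bar>w n\<bar> \<le> C"
  obtains l r where "strict_mono r" "(w \<circ> r) \<longlonglongrightarrow> l"
    "\<And>e. e > 0 \<Longrightarrow> eventually (\<lambda>n. w n < l + e) sequentially"
proof -
  obtain r where r: "strict_mono r" "((\<lambda>n. ereal (w n)) \<circ> r) \<longlonglongrightarrow> limsup (\<lambda>n. ereal (w n))"
    using limsup_subseq_lim by blast
  have "limsup (\<lambda>n. ereal (w n)) \<le> ereal C"
    using C by (intro Limsup_bounded) (auto intro!: always_eventually simp: abs_le_iff)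
  moreover have "ereal (- C) \<le> liminf (\<lambda>n. ereal (w n))"
    using C by (intro Liminf_bounded) (auto intro!: always_eventually simp: abs_le_iff minus_le_iff)
  then have "ereal (- C) \<le> limsup (\<lambda>n. ereal (w n))"
    using Liminf_le_Limsup[of sequentially "\<lambda>n. ereal (w n)"] by (auto intro: order_trans)
  ultimately obtain l where l: "limsup (\<lambda>n. ereal (w n)) = ereal l"
    by (cases "limsup (\<lambda>n. ereal (w n))") auto
  have "(w \<circ> r) \<longlonglongrightarrow> l" using r(2) l by (simp add: o_def)
  moreover have "eventually (\<lambda>n. w n < l + e) sequentially" if "e > 0" for e
    using Limsup_lessD[of sequentially "\<lambda>n. ereal (w n)" "ereal (l + e)"] l that by simp
  ultimately show ?thesis using that r(1) by blast
qed

lemma max_zero_tendsto: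
  fixes x :: "nat \<Rightarrow> real"
  assumes "\<And>e. e > 0 \<Longrightarrow> eventually (\<lambda>n. x n < e) sequentially"
  shows "(\<lambda>n. max 0 (x n)) \<longlonglongrightarrow> 0"
proof (rule tendstoI)
  fix e :: real assume "e > 0"
  from assms[OF this] show "eventually (\<lambda>n. dist (max 0 (x n)) 0 < e) sequentially"
    by eventually_elim (use \<open>e > 0\<close> in \<open>auto simp: dist_real_def\<close>)
qed

text \<open>Along a subsequence realising the limit superior \<open>l\<close>, the averages \<open>\<Sum> p k * (l - w (n - k))\<close>
  tend to 0 while the negative parts of the summands contribute nothing in the limit; so the
  positive parts must vanish as well.\<close>

lemma renewal_limsup_shift:
  fixes w p :: "nat \<Rightarrow> real"
  assumes p: "\<And>k. p k \<ge> 0" "p sums 1"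
    and rec: "\<And>n. n \<ge> 1 \<Longrightarrow> w n = (\<Sum>k\<le>n. p k * w (n - k))"
    and upper: "\<And>e. e > 0 \<Longrightarrow> eventually (\<lambda>n. w n < l + e) sequentially"
    and r: "filterlim r at_top sequentially" and lim: "(\<lambda>n. w (r n)) \<longlonglongrightarrow> l"
    and j: "p j > 0"
  shows "(\<lambda>n. w (r n - j)) \<longlonglongrightarrow> l"
proof -
  define neg pos where "neg n = max 0 (w n - l)" and "pos n = max 0 (l - w n)" for n
  have split: "l - w n = pos n - neg n" for n by (auto simp: neg_def pos_def)
  have neg0: "neg \<longlonglongrightarrow> 0"
    unfolding neg_def using upper
    by (intro max_zero_tendsto) (simp add: diff_less_eq add.commute)
  have "summable (\<lambda>k. \<bar>p k\<bar>)" using p by (simp add: sums_iff)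
  from tendsto_convolution[OF this neg0]
  have "(\<lambda>n. \<Sum>k\<le>n. p k * neg (n - k)) \<longlonglongrightarrow> 0" by simp
  then have N0: "(\<lambda>n. \<Sum>k\<le>r n. p k * neg (r n - k)) \<longlonglongrightarrow> 0"
    by (rule filterlim_compose[OF _ r])
  have "(\<lambda>n. \<Sum>k\<le>n. p k) \<longlonglongrightarrow> 1" using p(2) by (simp add: sums_def_le)
  then have "(\<lambda>n. \<Sum>k\<le>r n. p k) \<longlonglongrightarrow> 1" by (rule filterlim_compose[OF _ r])
  then have "(\<lambda>n. l * (\<Sum>k\<le>r n. p k) - w (r n)) \<longlonglongrightarrow> l * 1 - l"
    by (intro tendsto_intros lim)
  with N0 have "(\<lambda>n. (l * (\<Sum>k\<le>r n. p k) - w (r n)) + (\<Sum>k\<le>r n. p k * neg (r n - k))) \<longlonglongrightarrow> (l * 1 - l) + 0"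
    by (intro tendsto_add)
  \<comment> \<open>The recursion, valid once \<open>r n \<ge> 1\<close>, replaces the average of
    \<open>w\<close> by \<open>w (r n)\<close>.\<close>
  moreover have "eventually (\<lambda>n. (l * (\<Sum>k\<le>r n. p k) - w (r n)) + (\<Sum>k\<le>r n. p k * neg (r n - k))
      = (\<Sum>k\<le>r n. p k * pos (r n - k))) sequentially"
    using r[unfolded filterlim_at_top, rule_format, of 1]
  proof eventually_elim
    case (elim n)
    have "p k * pos (r n - k) = l * p k - p k * w (r n - k) + p k * neg (r n - k)" for k
    proof -
      have "pos (r n - k) = l - w (r n - k) + neg (r n - k)" using split[of "r n - k"] by simp
      then show ?thesis by (simp only: distrib_left right_diff_distrib) (simp add: mult.commute)
    qed
    then show ?case
      using rec[OF elim] by (simp add: sum.distrib sum_subtractf sum_distrib_left)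
  qed
  ultimately have P0: "(\<lambda>n. \<Sum>k\<le>r n. p k * pos (r n - k)) \<longlonglongrightarrow> 0"
    by (auto elim: Lim_transform_eventually)
  have "(\<lambda>n. p j * pos (r n - j)) \<longlonglongrightarrow> 0"
  proof (rule tendsto_sandwich[OF _ _ tendsto_const P0])
    show "eventually (\<lambda>n. 0 \<le> p j * pos (r n - j)) sequentially"
      using p by (auto simp: pos_def)
    show "eventually (\<lambda>n. p j * pos (r n - j) \<le> (\<Sum>k\<le>r n. p k * pos (r n - k))) sequentially"
      using r[unfolded filterlim_at_top, rule_format, of j]
      by eventually_elim (rule member_le_sum; use p in \<open>auto simp: pos_def\<close>)
  qed
  then have pos0: "(\<lambda>n. pos (r n - j)) \<longlonglongrightarrow> 0"
    using tendsto_mult_left[of "\<lambda>n. p j * pos (r n - j)" 0 sequentially "1 / p j"] j by simp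
  have "filterlim (\<lambda>n. r n - j) at_top sequentially"
    by (rule filterlim_compose[OF filterlim_minus_const_nat_at_top r])
  with neg0 have "(\<lambda>n. neg (r n - j)) \<longlonglongrightarrow> 0" by (rule filterlim_compose)
  with pos0 have "(\<lambda>n. l - (pos (r n - j) - neg (r n - j))) \<longlonglongrightarrow> l - (0 - 0)"
    by (intro tendsto_intros)
  then show ?thesis by (simp flip: split)
qed

text \<open>The tails \<open>\<rho>\<close> of \<open>p\<close> satisfy \<open>\<Sum>k\<le>n. \<rho> k * w (n - k) = w 0\<close> for every \<open>n\<close>;
  the mean of \<open>p\<close> is the sum of the tails.\<close>

lemma renewal_limsup:
  fixes w p \<rho> :: "nat \<Rightarrow> real"
  assumes p: "\<And>k. p k \<ge> 0" "p sums 1" "p 0 = 0" and gcd: "Gcd {k. p k > 0} = 1"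
    and rec: "\<And>n. n \<ge> 1 \<Longrightarrow> w n = (\<Sum>k\<le>n. p k * w (n - k))"
    and C: "\<And>n. \<bar>w n\<bar> \<le> C"
    and \<rho>: "\<And>k. \<rho> k = 1 - (\<Sum>i\<le>k. p i)" "\<rho> sums \<mu>" and \<mu>: "\<mu> > 0"
    and e: "e > 0"
  shows "eventually (\<lambda>n. w n < w 0 / \<mu> + e) sequentially"
proof -
  obtain l r where r: "strict_mono r" and lim: "(w \<circ> r) \<longlonglongrightarrow> l"
    and upper: "\<And>e. e > 0 \<Longrightarrow> eventually (\<lambda>n. w n < l + e) sequentially"
    by (rule bounded_limsup_subseq[of w C]) (use C in auto)
  have r_top: "filterlim r at_top sequentially"
    using r by (rule filterlim_subseq)
  \<comment> \<open>Shifts that preserve the limit \<open>l\<close> along every index sequence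
    tending to infinity; quantifying over all \<open>q\<close> makes the set closed under
    addition.\<close>
  define S where "S = {j. (\<forall>q. filterlim q at_top sequentially \<longrightarrow> (\<lambda>n. w (q n)) \<longlonglongrightarrow> l \<longrightarrow>
    (\<lambda>n. w (q n - j)) \<longlonglongrightarrow> l)}"
  have "{k. p k > 0} \<subseteq> S"
    using renewal_limsup_shift[OF p(1,2) rec upper] by (auto simp: S_def)
  then have "Gcd S dvd Gcd {k. p k > 0}" by (blast intro: Gcd_greatest Gcd_dvd)
  with gcd have "Gcd S = 1" by simp
  moreover have "0 \<in> S" by (simp add: S_def)
  moreover have "a + b \<in> S" if "a \<in> S" "b \<in> S" for a b
    unfolding S_def
  proof (safe)
    fix q :: "nat \<Rightarrow> nat" assume q: "filterlim q at_top sequentially" "(\<lambda>n. w (q n)) \<longlonglongrightarrow> l"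
    have "(\<lambda>n. w (q n - a)) \<longlonglongrightarrow> l" using that q by (auto simp: S_def)
    moreover have "filterlim (\<lambda>n. q n - a) at_top sequentially"
      by (rule filterlim_compose[OF filterlim_minus_const_nat_at_top q(1)])
    ultimately have "(\<lambda>n. w (q n - a - b)) \<longlonglongrightarrow> l" using that(2) unfolding S_def by blast
    then show "(\<lambda>n. w (q n - (a + b))) \<longlonglongrightarrow> l" by (simp add: diff_diff_left)
  qed
  ultimately obtain J where J: "\<And>j. j \<ge> J \<Longrightarrow> j \<in> S"
    using numerical_semigroup_cofinite by blast
  \<comment> \<open>Moving the base point back by \<open>J\<close> puts all further shifts into
    \<open>S\<close>.\<close>
  define N where "N n = r n - J" for n
  have N_top: "filterlim N at_top sequentially"
    unfolding N_def by (rule filterlim_compose[OF filterlim_minus_const_nat_at_top r_top])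
  have "(\<lambda>n. w (N n - k)) \<longlonglongrightarrow> l" for k
  proof -
    have "(\<lambda>n. w (r n - (J + k))) \<longlonglongrightarrow> l"
      using J[of "J + k"] r_top lim unfolding S_def by (auto simp: o_def)
    then show ?thesis by (simp add: N_def diff_diff_left)
  qed
  moreover have \<rho>0: "\<rho> k \<ge> 0" for k
    using sum_le_suminf[of p "{..k}"] p(1,2) by (auto simp: \<rho>(1) sums_iff)
  ultimately have conv: "(\<lambda>n. \<Sum>k\<le>N n. \<rho> k * w (N n - k)) \<longlonglongrightarrow> \<mu> * l"
    using tendsto_convolution_filter[of \<rho> w C N l] C N_top \<rho>(2) by (simp add: sums_iff)
  have "(\<Sum>k\<le>n. \<rho> k * w (n - k)) = w 0" for n
  proof (induction n)
    case 0
    then show ?case by (simp add: \<rho>(1) p(3))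
  next
    case (Suc n)
    have "\<rho> (Suc k) = \<rho> k - p (Suc k)" for k by (simp add: \<rho>(1))
    moreover have "w (Suc n) = (\<Sum>k\<le>n. p (Suc k) * w (n - k))"
      using rec[of "Suc n"] by (simp add: sum.atMost_Suc_shift p(3) del: sum.atMost_Suc)
    ultimately show ?case
      using Suc by (simp add: sum.atMost_Suc_shift \<rho>(1)[of 0] p(3) left_diff_distrib
          sum_subtractf del: sum.atMost_Suc)
  qed
  with conv have "\<mu> * l = w 0" by (simp add: LIMSEQ_const_iff)
  then have "l = w 0 / \<mu>" using \<mu> by (simp add: field_simps)
  then show ?thesis using upper[OF e] by simp
qed

text \<open>\<open>renewal_limsup\<close>, applied to \<open>u\<close> and to \<open>- u\<close>,
  bounds \<open>u\<close> eventually from above and from below by values close to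
  \<open>1 / \<mu>\<close>.\<close>

theorem renewal_theorem:
  fixes u p \<rho> :: "nat \<Rightarrow> real"
  assumes p: "\<And>k. p k \<ge> 0" "p sums 1" "p 0 = 0" and gcd: "Gcd {k. p k > 0} = 1"
    and rec: "\<And>n. n \<ge> 1 \<Longrightarrow> u n = (\<Sum>k\<le>n. p k * u (n - k))" and u0: "u 0 = 1"
    and \<rho>: "\<And>k. \<rho> k = 1 - (\<Sum>i\<le>k. p i)" "\<rho> sums \<mu>" and \<mu>: "\<mu> > 0"
  shows "u \<longlonglongrightarrow> 1 / \<mu>"
proof -
  have p_le: "(\<Sum>k\<le>n. p k) \<le> 1" for n
    using sum_le_suminf[of p "{..n}"] p(1,2) by (auto simp: sums_iff)
  have u: "0 \<le> u n \<and> u n \<le> 1" for n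
  proof (induction n rule: less_induct)
    case (less n)
    show ?case
    proof (cases "n = 0")
      case False
      \<comment> \<open>The induction hypothesis does not cover \<open>k = 0\<close>; there
        \<open>p 0 = 0\<close> makes the term vanish.\<close>
      have *: "0 \<le> p k * u (n - k) \<and> p k * u (n - k) \<le> p k" for k
        using less[of "n - k"] False p by (cases "k = 0") (auto simp: mult_left_le)
      have "(\<Sum>k\<le>n. p k * u (n - k)) \<le> (\<Sum>k\<le>n. p k)"
        using * by (intro sum_mono) auto
      moreover have "(\<Sum>k\<le>n. p k * u (n - k)) \<ge> 0"
        using * by (intro sum_nonneg) auto
      ultimately show ?thesis using rec[of n] False p_le[of n] by simp
    qed (simp add: u0)
  qed
  show ?thesis
  proof (rule tendstoI)
    fix e :: real assume e: "e > 0"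
    have "eventually (\<lambda>n. u n < 1 / \<mu> + e) sequentially"
      using renewal_limsup[where w = u and C = 1, OF p gcd rec _ \<rho> \<mu> e] u u0 by simp
    moreover have "eventually (\<lambda>n. - u n < - 1 / \<mu> + e) sequentially"
      using renewal_limsup[where w = "\<lambda>n. - u n" and C = 1, OF p gcd _ _ \<rho> \<mu> e] u u0 rec
      by (simp add: sum_negf)
    ultimately show "eventually (\<lambda>n. dist (u n) (1 / \<mu>) < e) sequentially"
      by eventually_elim (auto simp: dist_real_def abs_less_iff)
  qed
qed

subsection \<open>Series with values in \<open>[0,\<infinity>]\<close>\<close>

text \<open>Tonelli's theorem for the counting measure on \<open>nat\<close>.\<close>

lemma suminf_swap_ennreal:
  fixes f :: "nat \<Rightarrow> nat \<Rightarrow> ennreal"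
  shows "(\<Sum>i. \<Sum>j. f i j) = (\<Sum>j. \<Sum>i. f i j)"
  using nn_integral_suminf[of "\<lambda>j i. f i j" "count_space UNIV"]
  by (simp add: nn_integral_count_space_nat)

lemma suminf_sum_ennreal:
  fixes f :: "'a \<Rightarrow> nat \<Rightarrow> ennreal"
  shows "(\<Sum>n. \<Sum>i\<in>I. f i n) = (\<Sum>i\<in>I. \<Sum>n. f i n)"
  by (rule suminf_sum) simp

lemma suminf_Suc_ennreal:
  fixes f :: "nat \<Rightarrow> ennreal"
  shows "(\<Sum>n. f n) = f 0 + (\<Sum>n. f (Suc n))"
  using suminf_offset[of f 1] by (simp add: add.commute)

lemma term_le_suminf_ennreal:
  fixes f :: "nat \<Rightarrow> ennreal"
  shows "f k \<le> (\<Sum>n. f n)"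
  using sum_le_suminf[of f "{k}"] by simp

lemma suminf_shift_ennreal:
  fixes f :: "nat \<Rightarrow> ennreal"
  shows "(\<Sum>n. if k \<le> n then f (n - k) else 0) = (\<Sum>n. f n)"
  using suminf_offset[of "\<lambda>n. if k \<le> n then f (n - k) else 0" k] by simp

lemma Cauchy_product_ennreal:
  fixes a b :: "nat \<Rightarrow> ennreal"
  shows "(\<Sum>n. \<Sum>k\<le>n. a k * b (n - k)) = (\<Sum>n. a n) * (\<Sum>n. b n)"
proof -
  have "(\<Sum>n. \<Sum>k\<le>n. a k * b (n - k)) = (\<Sum>n. \<Sum>k. if k \<le> n then a k * b (n - k) else 0)"
    by (simp add: suminf_truncated)
  also have "\<dots> = (\<Sum>k. \<Sum>n. if k \<le> n then a k * b (n - k) else 0)"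
    by (rule suminf_swap_ennreal)
  also have "\<dots> = (\<Sum>k. a k * (\<Sum>n. b n))"
    by (simp add: suminf_shift_ennreal[of _ "\<lambda>n. a _ * b n"])
  finally show ?thesis by simp
qed

text \<open>There are \<open>Suc n\<close> pairs with \<open>i + j = n\<close>. This turns a sum of
  tails into a mean, and the product of the two eigenvectors into the mean age up to the factor
  \<open>m\<close>.\<close>

lemma suminf_antidiagonal_ennreal:
  fixes f :: "nat \<Rightarrow> ennreal"
  shows "(\<Sum>i. \<Sum>j. f (i + j)) = (\<Sum>n. of_nat (Suc n) * f n)"
proof -
  have "(\<Sum>j. f (i + j)) = (\<Sum>n. if i \<le> n then f n else 0)" for i
    using suminf_shift_ennreal[of i "\<lambda>j. f (i + j)"] by (simp cong: if_cong)
  then have "(\<Sum>i. \<Sum>j. f (i + j)) = (\<Sum>i. \<Sum>n. if i \<le> n then f n else 0)"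
    by simp
  also have "\<dots> = (\<Sum>n. \<Sum>i. if i \<le> n then f n else 0)"
    by (rule suminf_swap_ennreal)
  finally show ?thesis by (simp add: suminf_truncated)
qed

lemma tendsto_convolution_ennreal:
  fixes a b :: "nat \<Rightarrow> ennreal"
  assumes a: "(\<Sum>n. a n) < \<infinity>" and b: "b \<longlonglongrightarrow> L" and fin: "L < \<infinity>" "\<And>n. b n < \<infinity>"
  shows "(\<lambda>n. \<Sum>k\<le>n. a k * b (n - k)) \<longlonglongrightarrow> (\<Sum>n. a n) * L"
proof -
  define x y where "x n = enn2real (a n)" and "y n = enn2real (b n)" for n
  have "a n < \<infinity>" for n using a by (rule ennreal_suminf_lessD)
  then have ax: "a = (\<lambda>n. ennreal (x n))" by (simp add: x_def fun_eq_iff)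
  have bY: "b = (\<lambda>n. ennreal (y n))" using fin by (simp add: y_def fun_eq_iff)
  have x: "x n \<ge> 0" and y: "y n \<ge> 0" for n by (simp_all add: x_def y_def)
  have "summable x" using a x by (intro summable_suminf_not_top) (auto simp: ax)
  then have sx: "summable (\<lambda>k. \<bar>x k\<bar>)" and suma: "(\<Sum>n. a n) = ennreal (\<Sum>n. x n)"
    using x a by (auto simp: ax)
  have "y \<longlonglongrightarrow> enn2real L" unfolding y_def using b fin by (intro tendsto_enn2real) auto
  from tendsto_ennrealI[OF tendsto_convolution[OF sx this]]
  have "(\<lambda>n. ennreal (\<Sum>k\<le>n. x k * y (n - k))) \<longlonglongrightarrow> ennreal (suminf x * enn2real L)" .
  moreover have "ennreal (\<Sum>k\<le>n. x k * y (n - k)) = (\<Sum>k\<le>n. a k * b (n - k))" for n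
    using x y by (subst sum_ennreal[symmetric]) (auto simp: ax bY ennreal_mult)
  moreover have "ennreal (suminf x * enn2real L) = (\<Sum>n. a n) * L"
    using fin by (simp add: suma ennreal_mult'')
  ultimately show ?thesis by simp
qed

lemma conv_radius_ennreal:
  fixes c :: "nat \<Rightarrow> ennreal"
  assumes fin: "\<And>n. c n < \<infinity>" and R: "R \<ge> 0"
    and conv: "\<And>s. 0 < s \<Longrightarrow> s < R \<Longrightarrow> (\<Sum>n. c n * ennreal s ^ n) < \<infinity>"
    and div: "\<And>s. R < s \<Longrightarrow> (\<Sum>n. c n * ennreal s ^ n) = \<infinity>"
  shows "conv_radius (\<lambda>n. enn2real (c n)) = ereal R"
proof -
  have eq: "(\<Sum>n. c n * ennreal s ^ n) = (\<Sum>n. ennreal (enn2real (c n) * s ^ n))" if "s > 0" for s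
    using fin that by (intro suminf_cong) (simp add: ennreal_mult ennreal_power)
  show ?thesis
  proof (rule antisym)
    show "conv_radius (\<lambda>n. enn2real (c n)) \<le> ereal R"
    proof (rule conv_radius_leI_ex')
      fix s :: real assume s: "0 < s" "ereal R < ereal s"
      show "\<not> summable (\<lambda>n. enn2real (c n) * of_real s ^ n)"
      proof
        assume "summable (\<lambda>n. enn2real (c n) * of_real s ^ n)"
        then have "(\<Sum>n. ennreal (enn2real (c n) * s ^ n)) \<noteq> top"
          by (intro ennreal_suminf_neq_top) (use s in auto)
        with eq[of s] div[of s] s show False by simp
      qed
    qed (use R in simp)
    show "conv_radius (\<lambda>n. enn2real (c n)) \<ge> ereal R"
    proof (rule conv_radius_geI_ex')
      fix s :: real assume s: "0 < s" "ereal s < ereal R"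
      show "summable (\<lambda>n. enn2real (c n) * of_real s ^ n)"
      proof (rule summable_suminf_not_top)
        have "(\<Sum>n. c n * ennreal s ^ n) < \<infinity>" using s by (intro conv) auto
        then show "(\<Sum>n. ennreal (enn2real (c n) * of_real s ^ n)) \<noteq> top"
          unfolding eq[OF s(1)] by (simp only: of_real_eq_id id_apply infinity_ennreal_def less_top)
      qed (use s in simp)
    qed
  qed
qed

lemma suminf_lt_top_imp_tendsto_0_ennreal:
  fixes a :: "nat \<Rightarrow> ennreal"
  assumes a: "(\<Sum>n. a n) < \<infinity>"
  shows "a \<longlonglongrightarrow> 0"
proof -
  have "a n < \<infinity>" for n using a by (rule ennreal_suminf_lessD)
  then have ax: "a n = ennreal (enn2real (a n))" for n by simp
  have "summable (\<lambda>n. enn2real (a n))"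
    by (rule summable_suminf_not_top) (use a in \<open>simp_all flip: ax\<close>)
  from tendsto_ennrealI[OF summable_LIMSEQ_zero[OF this]] show ?thesis
    by (simp flip: ax)
qed

lemma Cauchy_product_power_ennreal:
  fixes a b :: "nat \<Rightarrow> ennreal"
  shows "(\<Sum>n. (\<Sum>k\<le>n. a k * b (n - k)) * s ^ n) = (\<Sum>n. a n * s ^ n) * (\<Sum>n. b n * s ^ n)"
proof -
  have "a k * b (n - k) * s ^ n = (a k * s ^ k) * (b (n - k) * s ^ (n - k))" if "k \<le> n" for k n
    using that by (simp add: ac_simps flip: power_add)
  then show ?thesis
    by (simp add: sum_distrib_right flip: Cauchy_product_ennreal)
qed

text \<open>All values are finite, so the real version applies; its sum of tails is the mean of
  \<open>p\<close> by counting antidiagonals.\<close>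

lemma renewal_theorem_ennreal:
  fixes u p :: "nat \<Rightarrow> ennreal"
  assumes p: "(\<Sum>k. p k) = 1" "p 0 = 0" and gcd: "Gcd {k. p k > 0} = 1"
    and rec: "\<And>n. n \<ge> 1 \<Longrightarrow> u n = (\<Sum>k\<le>n. p k * u (n - k))" and u0: "u 0 = 1"
    and \<mu>: "(\<Sum>k. of_nat k * p k) = \<mu>" "\<mu> < \<infinity>"
  shows "u n < \<infinity>" and "u \<longlonglongrightarrow> inverse \<mu>"
proof -
  have p_fin: "p k < \<infinity>" for k using p(1) ennreal_suminf_lessD[of p \<infinity> k] by simp
  show u_fin: "u n < \<infinity>" for n
  proof (induction n rule: less_induct)
    case (less n)
    show ?case
    proof (cases "n = 0")
      case False
      have "p k * u (n - k) < \<infinity>" for k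
        using less[of "n - k"] False p_fin[of k] p(2) by (cases "k = 0") (auto simp: ennreal_mult_less_top)
      then show ?thesis using rec[of n] False by simp
    qed (simp add: u0)
  qed
  define P where "P k = enn2real (p k)" for k
  define V where "V n = enn2real (u n)" for n
  have pP: "p k = ennreal (P k)" for k using p_fin[of k] by (simp add: P_def)
  have uV: "u k = ennreal (V k)" for k using u_fin[of k] by (simp add: V_def)
  have P0: "P k \<ge> 0" and V0: "V k \<ge> 0" for k by (simp_all add: P_def V_def)
  have "(\<Sum>k. ennreal (P k)) = 1" using p(1) by (simp flip: pP)
  then have Psums: "P sums 1"
    using P0 by (metis ennreal_1 ennreal_one_neq_top sums_ennreal summableI summable_sums zero_le_one)
  have Vrec: "V n = (\<Sum>k\<le>n. P k * V (n - k))" if "n \<ge> 1" for n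
  proof -
    have "ennreal (V n) = ennreal (\<Sum>k\<le>n. P k * V (n - k))"
      using rec[OF that] P0 V0 by (subst sum_ennreal[symmetric]) (auto simp: ennreal_mult pP uV)
    then show ?thesis using P0 V0 by (simp add: sum_nonneg)
  qed
  define \<rho> where "\<rho> k = 1 - (\<Sum>i\<le>k. P i)" for k
  have \<rho>0: "\<rho> k \<ge> 0" for k
    using sum_le_suminf[of P "{..k}"] P0 Psums by (auto simp: \<rho>_def sums_iff)
  have tail: "(\<Sum>j. p (Suc (k + j))) = ennreal (\<rho> k)" for k
  proof -
    have "P (j + Suc k) \<ge> 0" for j by (rule P0)
    moreover have "(\<lambda>j. P (j + Suc k)) sums \<rho> k"
      using sums_split_initial_segment[OF Psums, of "Suc k"] by (simp add: \<rho>_def lessThan_Suc_atMost)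
    ultimately have "(\<Sum>j. ennreal (P (j + Suc k))) = ennreal (\<rho> k)"
      by (rule suminf_ennreal_eq)
    then show ?thesis by (simp add: pP add.commute)
  qed
  have "(\<Sum>k. ennreal (\<rho> k)) = (\<Sum>k. of_nat (Suc k) * p (Suc k))"
    using suminf_antidiagonal_ennreal[of "\<lambda>n. p (Suc n)"] by (simp add: tail)
  also have "\<dots> = \<mu>" unfolding \<mu>(1)[symmetric] by (subst (2) suminf_Suc_ennreal) simp
  finally have \<rho>\<mu>: "(\<Sum>k. ennreal (\<rho> k)) = \<mu>" .
  have "\<mu> = ennreal (enn2real \<mu>)" using \<mu>(2) by simp
  then obtain r where r: "\<mu> = ennreal r" "r \<ge> 0" by simp
  have \<rho>sums: "\<rho> sums r"
    using sums_ennreal[OF \<rho>0 r(2)] \<rho>\<mu> r(1) summable_sums[OF summableI, of "\<lambda>k. ennreal (\<rho> k)"] by simp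
  \<comment> \<open>This tail alone makes the mean at least 1, hence positive.\<close>
  have "\<rho> 0 = 1" using p(2) by (simp add: \<rho>_def P_def)
  then have "r \<ge> 1" using sum_le_suminf[of \<rho> "{0}"] \<rho>0 \<rho>sums by (auto simp: sums_iff)
  have "{k. P k > 0} = {k. p k > 0}" using P0 by (auto simp: pP less_le)
  then have "V \<longlonglongrightarrow> 1 / r"
    using renewal_theorem[of P V \<rho> r] P0 Psums p(2) gcd Vrec u0 \<rho>_def \<rho>sums \<open>r \<ge> 1\<close>
    by (simp add: P_def V_def)
  from tendsto_ennrealI[OF this] show "u \<longlonglongrightarrow> inverse \<mu>"
    using \<open>r \<ge> 1\<close> by (simp add: r uV[symmetric] inverse_ennreal divide_inverse)
qed

subsection \<open>Matrix algebra\<close>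

declare mat_pow.simps(2) [simp del]

lemma mat_vec_mult: "mat_vec (mat_mult A B) x = mat_vec A (mat_vec B x)"
  unfolding mat_vec_def mat_mult_def
  by (subst suminf_swap_ennreal[of "\<lambda>i k. A _ k * B k i * x i", simplified, folded mult.assoc])
     (simp add: mult.assoc)

lemma vec_mat_mult: "vec_mat x (mat_mult A B) = vec_mat (vec_mat x A) B"
  unfolding vec_mat_def mat_mult_def
  by (simp flip: ennreal_suminf_cmult ennreal_suminf_multc add: mult.assoc)
     (subst suminf_swap_ennreal, simp)

lemma mat_mult_assoc: "mat_mult (mat_mult A B) C = mat_mult A (mat_mult B C)"
  unfolding mat_mult_def
  by (simp flip: ennreal_suminf_cmult ennreal_suminf_multc add: mult.assoc)
     (subst suminf_swap_ennreal, simp)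

lemma dotp_vec_mat: "dotp (vec_mat x A) y = dotp x (mat_vec A y)"
  unfolding dotp_def vec_mat_def mat_vec_def
  by (simp flip: ennreal_suminf_cmult ennreal_suminf_multc add: mult.assoc)
     (subst suminf_swap_ennreal, simp)

lemma suminf_single_ennreal:
  fixes f :: "nat \<Rightarrow> ennreal"
  assumes "\<And>k. k \<noteq> i \<Longrightarrow> f k = 0"
  shows "(\<Sum>k. f k) = f i"
  using assms by (subst suminf_finite[of "{i}"]) auto

lemma mat_mult_id [simp]: "mat_mult id_mat A = A" "mat_mult A id_mat = A"
proof -
  show "mat_mult id_mat A = A"
  proof (intro ext)
    fix i j show "mat_mult id_mat A i j = A i j"
      unfolding mat_mult_def by (subst suminf_single_ennreal[of i]) (auto simp: id_mat_def)
  qed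
  show "mat_mult A id_mat = A"
  proof (intro ext)
    fix i j show "mat_mult A id_mat i j = A i j"
      unfolding mat_mult_def by (subst suminf_single_ennreal[of j]) (auto simp: id_mat_def)
  qed
qed

lemma mat_vec_id [simp]: "mat_vec id_mat x = x"
proof
  fix i show "mat_vec id_mat x i = x i"
    unfolding mat_vec_def by (subst suminf_single_ennreal[of i]) (auto simp: id_mat_def)
qed

lemma vec_mat_id [simp]: "vec_mat x id_mat = x"
proof
  fix j show "vec_mat x id_mat j = x j"
    unfolding vec_mat_def by (subst suminf_single_ennreal[of j]) (auto simp: id_mat_def)
qed

lemma mat_pow_add: "mat_pow A (k + l) = mat_mult (mat_pow A k) (mat_pow A l)"
  by (induction l) (simp_all add: mat_mult_assoc mat_pow.simps(2))

lemma mat_pow_1 [simp]: "mat_pow A (Suc 0) = A"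
  by (simp add: mat_pow.simps(2))

lemma mat_pow_Suc_left: "mat_pow A (Suc n) = mat_mult A (mat_pow A n)"
  using mat_pow_add[of A 1 n] by simp

lemma mat_vec_mono: "(\<And>i. x i \<le> y i) \<Longrightarrow> mat_vec A x i \<le> mat_vec A y i"
  unfolding mat_vec_def by (intro suminf_le mult_left_mono) auto

lemma vec_mat_mono: "(\<And>i. x i \<le> y i) \<Longrightarrow> vec_mat x A j \<le> vec_mat y A j"
  unfolding vec_mat_def by (intro suminf_le mult_right_mono) auto

lemma dotp_mono: "(\<And>i. x i \<le> x' i) \<Longrightarrow> (\<And>i. y i \<le> y' i) \<Longrightarrow> dotp x y \<le> dotp x' y'"
  unfolding dotp_def by (intro suminf_le mult_mono) auto

lemma term_le_dotp: "x i * y i \<le> dotp x y"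
  unfolding dotp_def by (rule term_le_suminf_ennreal)

lemma term_le_mat_vec: "A i k * x k \<le> mat_vec A x i"
  unfolding mat_vec_def by (rule term_le_suminf_ennreal)

lemma entry_le_row_sum: "A i j \<le> mat_vec A ones i"
  using term_le_mat_vec[of A i j ones] by (simp add: ones_def)

lemma mat_vec_add: "mat_vec A (\<lambda>i. x i + y i) i = mat_vec A x i + mat_vec A y i"
  unfolding mat_vec_def by (simp add: distrib_left suminf_add)

lemma mat_vec_cmult: "mat_vec A (\<lambda>i. c * x i) i = c * mat_vec A x i"
  unfolding mat_vec_def by (simp add: mult.left_commute)

lemma vec_mat_cmult: "vec_mat (\<lambda>i. c * x i) A j = c * vec_mat x A j"
  unfolding vec_mat_def by (simp add: mult.assoc)

lemma dotp_cmult_left: "dotp (\<lambda>i. c * x i) y = c * dotp x y"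
  unfolding dotp_def by (simp add: mult.assoc)

lemma dotp_cmult_right: "dotp x (\<lambda>i. c * y i) = c * dotp x y"
  unfolding dotp_def by (simp add: mult.left_commute)

lemma mat_vec_suminf: "mat_vec A (\<lambda>i. \<Sum>k::nat. X k i) i = (\<Sum>k. mat_vec A (X k) i)"
  unfolding mat_vec_def
  by (simp flip: ennreal_suminf_cmult) (rule suminf_swap_ennreal)

lemma vec_mat_suminf: "vec_mat (\<lambda>i. \<Sum>k::nat. X k i) A j = (\<Sum>k. vec_mat (X k) A j)"
  unfolding vec_mat_def
  by (simp flip: ennreal_suminf_multc) (rule suminf_swap_ennreal)

lemma dotp_suminf_left: "dotp (\<lambda>i. \<Sum>k::nat. X k i) y = (\<Sum>k. dotp (X k) y)"
  unfolding dotp_def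
  by (simp flip: ennreal_suminf_multc) (rule suminf_swap_ennreal)

lemma dotp_suminf_right: "dotp x (\<lambda>i. \<Sum>k::nat. Y k i) = (\<Sum>k. dotp x (Y k))"
  unfolding dotp_def
  by (simp flip: ennreal_suminf_cmult) (rule suminf_swap_ennreal)

lemma dotp_sum_left: "dotp (\<lambda>i. \<Sum>k\<in>I. X k i) y = (\<Sum>k\<in>I. dotp (X k) y)"
  unfolding dotp_def by (simp add: sum_distrib_right suminf_sum_ennreal)

lemma mat_vec_sum: "mat_vec A (\<lambda>i. \<Sum>k\<in>I. X k i) i = (\<Sum>k\<in>I. mat_vec A (X k) i)"
  unfolding mat_vec_def by (simp add: sum_distrib_left suminf_sum_ennreal)

lemma vec_mat_sum: "vec_mat (\<lambda>i. \<Sum>k\<in>I. X k i) A j = (\<Sum>k\<in>I. vec_mat (X k) A j)"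
  unfolding vec_mat_def by (simp add: sum_distrib_right suminf_sum_ennreal)

text \<open>\<open>M\<close> is \<open>H\<close> plus a rank-one matrix, so beyond the action of
  \<open>H\<close> only a multiple of \<open>g\<close> appears.\<close>

lemma vec_mat_mean_matrix:
  "vec_mat x (mean_matrix H g m) j = vec_mat x H j + ennreal m * dotp x (mat_vec H ones) * g j"
proof -
  have "vec_mat x (mean_matrix H g m) j
      = (\<Sum>k. x k * H k j + ennreal m * (x k * mat_vec H ones k) * g j)"
    unfolding vec_mat_def mean_matrix_def by (simp add: distrib_left mult.assoc mult.left_commute)
  also have "\<dots> = vec_mat x H j + (\<Sum>k. ennreal m * (x k * mat_vec H ones k) * g j)"
    unfolding vec_mat_def by (subst suminf_add) auto
  finally show ?thesis by (simp add: dotp_def)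
qed

lemma mat_vec_mean_matrix:
  "mat_vec (mean_matrix H g m) x i = mat_vec H x i + ennreal m * mat_vec H ones i * dotp g x"
proof -
  have "mat_vec (mean_matrix H g m) x i
      = (\<Sum>k. H i k * x k + (ennreal m * mat_vec H ones i) * (g k * x k))"
    unfolding mat_vec_def[of "mean_matrix H g m"]
    unfolding mean_matrix_def
    by (simp add: distrib_right mult.assoc)
  also have "\<dots> = (\<Sum>k. H i k * x k) + (\<Sum>k. (ennreal m * mat_vec H ones i) * (g k * x k))"
    by (subst suminf_add) auto
  finally show ?thesis by (simp add: dotp_def mat_vec_def[of H x])
qed

subsection \<open>The renewal decomposition\<close>

locale linear_fractional =
  fixes H :: nnmat and g :: nnvec and m :: real
  assumes sub_stochastic: "sub_stochastic H" and prob_vec: "prob_vec g" and m_pos: "m > 0"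
begin

abbreviation M :: nnmat where "M \<equiv> mean_matrix H g m"
abbreviation h :: "nat \<Rightarrow> nnvec" where "h k \<equiv> mat_vec (mat_pow H k) ones"
abbreviation b :: "nat \<Rightarrow> nnvec" where "b k \<equiv> vec_mat g (mat_pow H k)"
abbreviation w :: "nat \<Rightarrow> nnvec" where "w n \<equiv> vec_mat g (mat_pow M n)"
abbreviation d :: "nat \<Rightarrow> ennreal" where "d \<equiv> cmj_d H g"
abbreviation f :: "real \<Rightarrow> ennreal" where "f \<equiv> cmj_f H g"

text \<open>\<open>u\<close> is the renewal sequence with increment weights \<open>m * d n\<close>, see \<open>renewal_Suc\<close>.\<close>

definition u :: "nat \<Rightarrow> ennreal" where
  "u n = (case n of 0 \<Rightarrow> 1 | Suc k \<Rightarrow> ennreal m * dotp (w k) (h 1))"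

lemma u_0 [simp]: "u 0 = 1"
  by (simp add: u_def)

lemma mat_vec_h: "mat_vec H (h k) = h (Suc k)"
  by (simp only: mat_pow_Suc_left mat_vec_mult)

lemma vec_mat_b: "vec_mat (b k) H = b (Suc k)"
  by (simp add: vec_mat_mult mat_pow.simps(2))

lemma dotp_b_h: "dotp (b l) (h k) = d (l + k)"
  by (simp add: cmj_d_def mat_pow_add vec_mat_mult dotp_vec_mat mat_vec_mult)

lemma dotp_g_h: "dotp g (h k) = d k"
  using dotp_b_h[of 0 k] by simp

lemma dotp_g_ones: "dotp g ones = 1"
  using prob_vec by (simp add: dotp_def prob_vec_def ones_def)

lemma d_0: "d 0 = 1"
  by (simp add: cmj_d_def dotp_g_ones)

lemma h_le_ones: "h k i \<le> ones i"
proof (induction k arbitrary: i)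
  case (Suc k)
  have "h (Suc k) i \<le> mat_vec H ones i"
    unfolding mat_vec_h[symmetric] by (rule mat_vec_mono) (rule Suc)
  also have "\<dots> \<le> ones i"
    using sub_stochastic by (simp add: sub_stochastic_def mat_vec_def ones_def)
  finally show ?case .
qed simp

lemma d_le_1: "d k \<le> 1"
  unfolding dotp_g_h[symmetric] dotp_g_ones[symmetric]
  by (rule dotp_mono) (simp_all add: h_le_ones)

text \<open>Decomposition at the last rank-one factor, or at the start if there is none:
  \<open>k\<close> steps of \<open>H\<close> from \<open>g\<close> follow it. Inductively, one more
  \<open>M\<close> either extends by \<open>H\<close> or restarts from \<open>g\<close> with weight
  \<open>u (Suc n)\<close>.\<close>

lemma w_eq: "w n j = (\<Sum>k\<le>n. b k j * u (n - k))"
proof (induction n arbitrary: j)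
  case (Suc n)
  have "w (Suc n) j = vec_mat (w n) H j + u (Suc n) * g j"
    by (simp add: vec_mat_mult vec_mat_mean_matrix u_def mat_pow.simps(2))
  also have "w n = (\<lambda>i. \<Sum>k\<le>n. u (n - k) * b k i)"
    using Suc by (auto simp: mult.commute)
  also have "vec_mat \<dots> H j = (\<Sum>k\<le>n. u (n - k) * b (Suc k) j)"
    by (simp only: vec_mat_sum vec_mat_cmult vec_mat_b)
  also have "\<dots> + u (Suc n) * g j = (\<Sum>k\<le>Suc n. b k j * u (Suc n - k))"
    by (simp add: sum.atMost_Suc_shift mult.commute add.commute del: sum.atMost_Suc)
  finally show ?case .
qed simp

text \<open>Pairing the decomposition of \<open>w n\<close> with \<open>h 1\<close> turns each
  \<open>b k\<close> into \<open>d (Suc k)\<close>.\<close>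

lemma renewal_Suc: "u (Suc n) = (\<Sum>k\<le>n. ennreal m * d (Suc k) * u (n - k))"
proof -
  have "w n = (\<lambda>i. \<Sum>k\<le>n. u (n - k) * b k i)"
    using w_eq by (auto simp: mult.commute)
  then have "u (Suc n) = ennreal m * (\<Sum>k\<le>n. u (n - k) * d (Suc k))"
    by (simp add: u_def dotp_sum_left dotp_cmult_left dotp_b_h[where k = 1, simplified])
  then show ?thesis by (simp add: sum_distrib_left mult.assoc mult.commute[of "u _"])
qed

text \<open>Decomposition at the first rank-one factor, placed at step \<open>Suc k\<close>: the
  \<open>k\<close> preceding copies of \<open>H\<close> and the \<open>H\<close> inside the factor
  combine to \<open>h (Suc k)\<close>.\<close>

lemma mat_pow_M:
  "mat_pow M n i j = mat_pow H n i j + ennreal m * (\<Sum>k<n. h (Suc k) i * w (n - Suc k) j)"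
proof (induction n arbitrary: i)
  case (Suc n)
  have col: "mat_mult A B i j = mat_vec A (\<lambda>k. B k j) i" for A B :: nnmat and i
    by (simp add: mat_mult_def mat_vec_def)
  have "mat_pow M (Suc n) i j = mat_vec H (\<lambda>k. mat_pow M n k j) i + ennreal m * h 1 i * w n j"
    unfolding mat_pow_Suc_left col mat_vec_mean_matrix
    by (simp add: dotp_def vec_mat_def)
  also have "(\<lambda>k. mat_pow M n k j)
      = (\<lambda>i. mat_pow H n i j + ennreal m * (\<Sum>k<n. w (n - Suc k) j * h (Suc k) i))"
    by (intro ext) (simp only: Suc mult.commute)
  also have "mat_vec H \<dots> i = mat_vec H (\<lambda>k. mat_pow H n k j) i
      + ennreal m * mat_vec H (\<lambda>i. \<Sum>k<n. w (n - Suc k) j * h (Suc k) i) i"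
    by (simp only: mat_vec_add mat_vec_cmult)
  also have "mat_vec H (\<lambda>k. mat_pow H n k j) i = mat_pow H (Suc n) i j"
    unfolding mat_pow_Suc_left col ..
  also have "mat_vec H (\<lambda>i. \<Sum>k<n. w (n - Suc k) j * h (Suc k) i) i
      = (\<Sum>k<n. w (n - Suc k) j * h (Suc (Suc k)) i)"
    by (simp only: mat_vec_sum mat_vec_cmult mat_vec_h)
  finally show ?case
    by (simp add: sum.lessThan_Suc_shift distrib_left ac_simps del: sum.lessThan_Suc)
qed simp

section \<open>Generating functions of the renewal decomposition\<close>

definition gen_h :: "ennreal \<Rightarrow> nnvec" where
  "gen_h s = (\<lambda>i. \<Sum>k. s ^ Suc k * h (Suc k) i)"

text \<open>Unlike \<open>gen_h\<close>, this starts at power 0: the rank-one part of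
  \<open>M\<close> carries an \<open>H\<close> to the left of \<open>ones\<close> but none to the
  right of \<open>g\<close>.\<close>

definition gen_b :: "ennreal \<Rightarrow> nnvec" where
  "gen_b s = (\<lambda>j. \<Sum>k. s ^ k * b k j)"

definition gen_u :: "ennreal \<Rightarrow> ennreal" where
  "gen_u s = (\<Sum>n. u n * s ^ n)"

text \<open>The renewal equation in generating-function form. As \<open>gen_u\<close> may be
  infinite, it cannot be solved by subtraction; the next two lemmas treat the two cases.\<close>

lemma gen_u_eq: "gen_u (ennreal s) = 1 + ennreal m * f s * gen_u (ennreal s)"
proof -
  have "gen_u (ennreal s) = 1 + (\<Sum>n. (\<Sum>k\<le>n. ennreal m * d (Suc k) * u (n - k)) * ennreal s ^ n) * ennreal s"
    unfolding gen_u_def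
    by (subst suminf_Suc_ennreal) (simp add: renewal_Suc mult.assoc mult.commute[of "ennreal s"] flip: ennreal_suminf_multc)
  also have "\<dots> = 1 + ((\<Sum>n. ennreal m * d (Suc n) * ennreal s ^ n) * ennreal s) * gen_u (ennreal s)"
    unfolding Cauchy_product_power_ennreal[of "\<lambda>k. ennreal m * d (Suc k)" u] gen_u_def
    by (simp only: ac_simps)
  also have "(\<Sum>n. ennreal m * d (Suc n) * ennreal s ^ n) * ennreal s = ennreal m * f s"
    unfolding cmj_f_def by (simp add: ac_simps flip: ennreal_suminf_multc ennreal_suminf_cmult)
  finally show ?thesis .
qed

text \<open>The renewal equation gives \<open>1 + x \<le> x\<close> for the value \<open>x\<close>,
  which only infinity satisfies.\<close>

lemma gen_u_infinite:
  assumes "1 \<le> ennreal m * f s"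
  shows "gen_u (ennreal s) = \<infinity>"
proof -
  have "1 + gen_u (ennreal s) \<le> gen_u (ennreal s)"
    by (subst (2) gen_u_eq) (use mult_right_mono[OF assms, of "gen_u (ennreal s)"] in simp)
  then show ?thesis by (cases "gen_u (ennreal s)") (auto simp flip: ennreal_1 ennreal_plus)
qed

text \<open>Infinity may solve the renewal equation too, so the partial sums are bounded inductively
  by \<open>1 / (1 - q)\<close>, the fixed point of \<open>x = 1 + q * x\<close> for
  \<open>q = m * f s\<close>.\<close>

lemma gen_u_finite:
  assumes q: "ennreal m * f s < 1"
  shows "gen_u (ennreal s) < \<infinity>"
proof -
  obtain q where q: "ennreal m * f s = ennreal q" "0 \<le> q" "q < 1"
    using q by (cases "ennreal m * f s") (auto simp: ennreal_less_one_iff)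
  \<comment> \<open>Truncating \<open>u\<close> makes a partial sum a full series, to which the
    Cauchy product applies.\<close>
  define v where "v N n = (if n < N then u n else 0)" for N n
  have v_eq: "(\<Sum>n. v N n * ennreal s ^ n) = (\<Sum>n<N. u n * ennreal s ^ n)" for N
    by (subst suminf_finite[of "{..<N}"]) (auto simp: v_def)
  have bound: "(\<Sum>n<N. u n * ennreal s ^ n) \<le> ennreal (1 / (1 - q))" for N
  proof (induction N)
    case (Suc N)
    have "(\<Sum>n<Suc N. u n * ennreal s ^ n) = 1 + (\<Sum>n<N. u (Suc n) * ennreal s ^ Suc n)"
      by (simp add: sum.lessThan_Suc_shift del: sum.lessThan_Suc)
    also have "(\<Sum>n<N. u (Suc n) * ennreal s ^ Suc n)
        \<le> (\<Sum>n<N. (\<Sum>k\<le>n. ennreal m * d (Suc k) * v N (n - k)) * ennreal s ^ Suc n)"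
      by (intro sum_mono) (auto simp: renewal_Suc v_def intro!: mult_right_mono sum_mono)
    also have "\<dots> \<le> (\<Sum>n. (\<Sum>k\<le>n. ennreal m * d (Suc k) * v N (n - k)) * ennreal s ^ Suc n)"
      by (intro sum_le_suminf) auto
    also have "\<dots> = (\<Sum>n. (\<Sum>k\<le>n. ennreal m * d (Suc k) * v N (n - k)) * ennreal s ^ n) * ennreal s"
      by (simp add: mult.assoc mult.commute[of "ennreal s"] flip: ennreal_suminf_multc)
    also have "\<dots> = ((\<Sum>n. ennreal m * d (Suc n) * ennreal s ^ n) * ennreal s) * (\<Sum>n<N. u n * ennreal s ^ n)"
      unfolding Cauchy_product_power_ennreal[of "\<lambda>k. ennreal m * d (Suc k)" "v N"] v_eq
      by (simp only: ac_simps)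
    also have "(\<Sum>n. ennreal m * d (Suc n) * ennreal s ^ n) * ennreal s = ennreal m * f s"
      unfolding cmj_f_def by (simp add: ac_simps flip: ennreal_suminf_multc ennreal_suminf_cmult)
    also have "\<dots> * (\<Sum>n<N. u n * ennreal s ^ n) \<le> ennreal q * ennreal (1 / (1 - q))"
      unfolding q(1) by (intro mult_left_mono Suc) simp
    also have "1 + \<dots> = ennreal (1 / (1 - q))"
      using q by (simp add: field_simps flip: ennreal_mult ennreal_1 ennreal_plus)
    finally show ?case by (simp add: add_left_mono)
  qed (use q in simp)
  have "gen_u (ennreal s) \<le> ennreal (1 / (1 - q))"
    unfolding gen_u_def by (intro suminf_le_const bound) simp
  from le_less_trans[OF this ennreal_less_top] show ?thesis by simp
qed

lemma suminf_mat_pow_M: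
  "(\<Sum>n. mat_pow M n i j * ennreal s ^ n) =
    (\<Sum>n. mat_pow H n i j * ennreal s ^ n)
      + ennreal m * gen_h (ennreal s) i * (gen_b (ennreal s) j * gen_u (ennreal s))"
proof -
  let ?s = "ennreal s"
  have "(\<Sum>n. mat_pow M n i j * ?s ^ n) = (\<Sum>n. mat_pow H n i j * ?s ^ n)
      + ennreal m * (\<Sum>n. (\<Sum>k<n. h (Suc k) i * w (n - Suc k) j) * ?s ^ n)"
    unfolding ennreal_suminf_cmult[symmetric]
    by (subst suminf_add) (auto simp: mult.assoc distrib_right mat_pow_M[of _ i] intro!: suminf_cong)
  \<comment> \<open>The inner sum is empty at \<open>n = 0\<close>; the index shift releases one
    factor \<open>s\<close>.\<close>
  also have "(\<Sum>n. (\<Sum>k<n. h (Suc k) i * w (n - Suc k) j) * ?s ^ n)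
      = (\<Sum>n. (\<Sum>k\<le>n. h (Suc k) i * w (n - k) j) * ?s ^ n) * ?s"
    by (subst suminf_Suc_ennreal)
      (simp add: lessThan_Suc_atMost mult.assoc mult.commute[of ?s] flip: ennreal_suminf_multc)
  also have "\<dots> = gen_h ?s i * (\<Sum>n. w n j * ?s ^ n)"
    unfolding Cauchy_product_power_ennreal[of "\<lambda>k. h (Suc k) i" "\<lambda>k. w k j"] gen_h_def
    by (simp add: ac_simps flip: ennreal_suminf_multc)
  also have "(\<Sum>n. w n j * ?s ^ n) = gen_b ?s j * gen_u ?s"
    unfolding w_eq Cauchy_product_power_ennreal[of "\<lambda>k. b k j"] gen_b_def gen_u_def
    by (simp add: mult.commute)
  finally show ?thesis by (simp add: mult.assoc)
qed

subsection \<open>Irreducibility\<close>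

text \<open>In a zero row of \<open>H\<close> the row sum vanishes too, so the rank-one part
  contributes nothing and the row of \<open>M\<close> is zero.\<close>

lemma irreducible_imp_no_zero_row:
  assumes "mat_irreducible M"
  shows "\<not> zero_row H i"
proof
  assume "zero_row H i"
  then have zero: "mat_mult H A i j = 0" "mat_vec H x i = 0" for A x j
    by (auto simp: zero_row_def mat_mult_def mat_vec_def)
  have "mat_pow M (Suc n) i i = 0" for n
    unfolding mat_pow_Suc_left mat_mult_def mean_matrix_def zero
    using \<open>zero_row H i\<close> by (simp add: zero_row_def)
  moreover obtain n where "n \<ge> 1" "mat_pow M n i i > 0"
    using assms unfolding mat_irreducible_def by blast
  ultimately show False by (metis Suc_le_D One_nat_def less_irrefl)
qed

lemma ex_g_pos: "\<exists>i. g i > 0"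
proof (rule ccontr)
  assume "\<not> ?thesis"
  then have "g = (\<lambda>_. 0)" by (auto simp: not_less)
  then show False using dotp_g_ones by (simp add: dotp_def)
qed

text \<open>No restart from \<open>g\<close> reaches a phantom type \<open>j\<close>, and from a
  type \<open>i\<close> charged by \<open>g\<close> the powers of \<open>H\<close> alone do not
  reach it either. So \<open>M\<close> never leads from \<open>i\<close> to
  \<open>j\<close>.\<close>

lemma irreducible_imp_no_phantom:
  assumes "mat_irreducible M"
  shows "\<not> phantom_type H g j"
proof
  assume "phantom_type H g j"
  then have b0: "b k j = 0" for k by (simp add: phantom_type_def)
  then have w0: "w n j = 0" for n by (simp add: w_eq)
  obtain i where i: "g i > 0" using ex_g_pos by blast
  have "mat_pow H n i j = 0" for n
  proof -
    have "g i * mat_pow H n i j \<le> b n j"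
      unfolding vec_mat_def by (rule term_le_suminf_ennreal)
    then show ?thesis using i b0[of n] by (auto simp: zero_less_iff_neq_zero)
  qed
  then have "mat_pow M n i j = 0" for n by (simp add: mat_pow_M[of n i] w0)
  moreover obtain n where "mat_pow M n i j > 0" using assms unfolding mat_irreducible_def by blast
  ultimately show False by simp
qed

end

locale irreducible_linear_fractional = linear_fractional +
  assumes no_phantom: "\<And>j. \<not> phantom_type H g j"
    and no_zero_row: "\<And>i. \<not> zero_row H i"
begin

lemma h_pos: "h k i > 0"
proof (induction k arbitrary: i)
  case (Suc k)
  obtain j where "H i j > 0"
    using no_zero_row[of i] by (auto simp: zero_row_def zero_less_iff_neq_zero)
  then have "0 < H i j * h k j" using Suc by (simp add: ennreal_zero_less_mult_iff)
  also have "\<dots> \<le> h (Suc k) i"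
    unfolding mat_vec_h[symmetric] by (rule term_le_mat_vec)
  finally show ?case .
qed (simp add: ones_def)

text \<open>The case \<open>d 1 > 0\<close> later yields the growth of \<open>f\<close> and the
  aperiodicity of the renewal weights.\<close>

lemma d_pos: "d k > 0"
proof -
  obtain i where "g i > 0" using ex_g_pos by blast
  then have "0 < g i * h k i" using h_pos by (simp add: ennreal_zero_less_mult_iff)
  also have "\<dots> \<le> d k" unfolding dotp_g_h[symmetric] by (rule term_le_dotp)
  finally show ?thesis .
qed

lemma ex_b_pos: "\<exists>k. b k j > 0"
  using no_phantom[of j] by (auto simp: phantom_type_def zero_less_iff_neq_zero)

text \<open>One step from \<open>i\<close> restarts from \<open>g\<close> with positive weight since
  \<open>h 1 i > 0\<close>, and \<open>k\<close> further steps of \<open>H\<close> reach the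
  non-phantom type \<open>j\<close>.\<close>

lemma irreducible: "mat_irreducible M"
  unfolding mat_irreducible_def
proof (intro allI)
  fix i j
  obtain k where k: "b k j > 0" using ex_b_pos by blast
  have "0 < ennreal m * (h 1 i * b k j)"
    using k h_pos[of 1 i] m_pos by (simp add: ennreal_zero_less_mult_iff)
  also have "h 1 i * b k j \<le> h 1 i * w k j"
  proof (rule mult_left_mono)
    \<comment> \<open>The term of \<open>w_eq\<close> without any renewal, where
      \<open>u 0 = 1\<close>.\<close>
    have "b k j * u (k - k) \<le> w k j" unfolding w_eq by (rule member_le_sum) auto
    then show "b k j \<le> w k j" by simp
  qed simp
  also have "h 1 i * w k j \<le> (\<Sum>l<Suc k. h (Suc l) i * w (Suc k - Suc l) j)"
    using member_le_sum[of 0 "{..<Suc k}" "\<lambda>l. h (Suc l) i * w (Suc k - Suc l) j"] by simp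
  also have "ennreal m * \<dots> \<le> mat_pow M (Suc k) i j"
    by (subst mat_pow_M) simp
  finally show "\<exists>n\<ge>1. mat_pow M n i j > 0" by (intro exI[of _ "Suc k"]) (auto simp: mult_left_mono)
qed

end

context linear_fractional
begin

lemma irreducible_iff:
  "mat_irreducible M \<longleftrightarrow> (\<forall>j. \<not> phantom_type H g j) \<and> (\<forall>i. \<not> zero_row H i)"
proof
  assume "(\<forall>j. \<not> phantom_type H g j) \<and> (\<forall>i. \<not> zero_row H i)"
  then interpret irreducible_linear_fractional H g m
    by unfold_locales auto
  show "mat_irreducible M" by (rule irreducible)
qed (use irreducible_imp_no_phantom irreducible_imp_no_zero_row in blast)

subsection \<open>The Malthusian parameter\<close>

lemma f_mono: "s \<le> t \<Longrightarrow> f s \<le> f t"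
  unfolding cmj_f_def by (intro suminf_le mult_left_mono power_mono_ennreal ennreal_leI) auto

text \<open>\<open>f\<close> has no constant term, so \<open>f s / s\<close> is nondecreasing. This
  gives uniqueness of the Malthusian solution and strict inequality below it.\<close>

lemma f_le_ratio:
  assumes "0 \<le> s" "s \<le> t" "0 < t"
  shows "f s \<le> ennreal (s / t) * f t"
proof -
  have "s ^ Suc n \<le> (s / t) * t ^ Suc n" for n
    using assms by (simp add: mult_left_mono power_mono)
  then have "ennreal s ^ Suc n \<le> ennreal (s / t) * ennreal t ^ Suc n" for n
    using assms by (simp add: ennreal_power flip: ennreal_mult del: power_Suc)
  from mult_left_mono[OF this, of "d (Suc _)"]
  have "d (Suc n) * ennreal s ^ Suc n \<le> ennreal (s / t) * (d (Suc n) * ennreal t ^ Suc n)" for n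
    by (simp only: mult.left_commute[of "d _"]) simp
  then show ?thesis
    unfolding cmj_f_def ennreal_suminf_cmult[symmetric] by (intro suminf_le) auto
qed

text \<open>A geometric series dominates because \<open>d n \<le> 1\<close>; consequently the radius
  \<open>cmj_Rf\<close> is at least 1.\<close>

lemma f_finite:
  assumes "0 \<le> s" "s < 1"
  shows "f s < \<infinity>"
proof -
  have "f s \<le> (\<Sum>n. ennreal (s ^ Suc n))"
    unfolding cmj_f_def
  proof (intro suminf_le)
    fix n show "d (Suc n) * ennreal s ^ Suc n \<le> ennreal (s ^ Suc n)"
      using assms mult_right_mono[OF d_le_1, of "ennreal s ^ Suc n" "Suc n"]
      by (simp only: ennreal_power mult_1 zero_le)
  qed auto
  also have "\<dots> < \<infinity>"
  proof -
    have "summable (\<lambda>n. s ^ Suc n)" using assms by simp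
    then have "(\<Sum>n. ennreal (s ^ Suc n)) \<noteq> top"
      using assms by (intro ennreal_suminf_neq_top) auto
    then show ?thesis by (simp only: infinity_ennreal_def less_top)
  qed
  finally show ?thesis .
qed

lemma mult_eq_1_iff: "ennreal m * x = 1 \<longleftrightarrow> x = ennreal (1 / m)"
  using m_pos by (cases x) (auto simp: field_simps ennreal_mult_top simp flip: ennreal_mult ennreal_1)

lemma mult_less_1_iff: "ennreal m * x < 1 \<longleftrightarrow> x < ennreal (1 / m)"
  using m_pos by (cases x) (auto simp: field_simps ennreal_mult_top ennreal_less_iff simp flip: ennreal_mult ennreal_1)

text \<open>The intermediate value theorem on the interval from 0 to \<open>t\<close>. The point
  \<open>K\<close> beyond \<open>t\<close> puts this interval strictly inside the disc of
  convergence, where the series is continuous.\<close>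

lemma f_solution_exists:
  assumes K: "0 < t" "t < K" "f K < \<infinity>" and t: "f t \<ge> ennreal (1 / m)"
  obtains s where "0 < s" "ennreal m * f s = 1"
proof -
  define a where "a n = enn2real (d (Suc n))" for n
  have da: "d (Suc n) = ennreal (a n)" for n
    using d_le_1[of "Suc n"] by (simp add: a_def le_less_trans)
  have a: "a n \<ge> 0" for n by (simp add: a_def)
  \<comment> \<open>Factoring out \<open>s\<close> leaves a power series starting at exponent 0, the
    form that \<open>isCont_powser\<close> expects.\<close>
  define F where "F s = s * (\<Sum>n. a n * s ^ n)" for s :: real
  have f_term: "d (Suc n) * ennreal s ^ Suc n = ennreal (s * (a n * s ^ n))" if "s \<ge> 0" for n s
    using that a[of n] by (simp add: da ennreal_mult ennreal_power ac_simps)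
  have fF: "f s = ennreal (F s)" and sum: "s > 0 \<Longrightarrow> summable (\<lambda>n. a n * s ^ n)"
    if s: "s \<ge> 0" "f s < \<infinity>" for s
  proof -
    have f: "f s = (\<Sum>n. ennreal (s * (a n * s ^ n)))"
      unfolding cmj_f_def using s(1) by (simp only: f_term)
    then have "summable (\<lambda>n. s * (a n * s ^ n))"
      using s a by (intro summable_suminf_not_top) auto
    then show "s > 0 \<Longrightarrow> summable (\<lambda>n. a n * s ^ n)" by (simp add: summable_cmult_iff)
    then show "f s = ennreal (F s)"
      using s a f by (cases "s = 0") (simp_all add: F_def suminf_mult suminf_nonneg)
  qed
  have "isCont F x" if "0 \<le> x" "x \<le> t" for x
    unfolding F_def using that K sum[of K]
    by (intro continuous_intros isCont_powser[of a K]) auto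
  moreover have "F 0 \<le> 1 / m" using m_pos by (simp add: F_def)
  moreover have "f t < \<infinity>" using f_mono[of t K] K by (simp add: le_less_trans)
  then have "1 / m \<le> F t" using fF[of t] t K m_pos sum[of t] a
    by (simp add: ennreal_le_iff F_def suminf_nonneg)
  ultimately obtain x where x: "0 \<le> x" "x \<le> t" "F x = 1 / m"
    using IVT[of F 0 "1 / m" t] K by auto
  have "f x < \<infinity>" using f_mono[of x K] x K by (simp add: le_less_trans)
  then have "ennreal m * f x = 1" using fF[of x] x by (simp add: mult_eq_1_iff)
  moreover have "x \<noteq> 0" using x(3) m_pos by (auto simp: F_def)
  ultimately show ?thesis using that[of x] x(1) by simp
qed

text \<open>Some partial sum already exceeds \<open>c\<close> at \<open>\<rho>\<close> and, being a
  polynomial, still does so slightly to the left. The value \<open>f \<rho>\<close> may be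
  infinite.\<close>

lemma f_left_continuous:
  assumes "0 < \<rho>" "c < f \<rho>"
  obtains t where "0 < t" "t < \<rho>" "c < f t"
proof -
  define a where "a n = enn2real (d (Suc n))" for n
  have da: "d (Suc n) = ennreal (a n)" for n
    using d_le_1[of "Suc n"] by (simp add: a_def le_less_trans)
  have a: "a n \<ge> 0" for n by (simp add: a_def)
  have part: "(\<Sum>n<N. d (Suc n) * ennreal s ^ Suc n) = ennreal (\<Sum>n<N. a n * s ^ Suc n)"
    if "s \<ge> 0" for s N
    using that a by (simp add: da ennreal_mult ennreal_power flip: sum_ennreal)
  have "(\<lambda>N. \<Sum>n<N. d (Suc n) * ennreal \<rho> ^ Suc n) \<longlonglongrightarrow> f \<rho>"
    unfolding cmj_f_def by (intro summable_LIMSEQ) simp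
  from order_tendstoD(1)[OF this assms(2)]
  obtain N where "c < (\<Sum>n<N. d (Suc n) * ennreal \<rho> ^ Suc n)"
    by (auto simp: eventually_sequentially simp del: power_Suc)
  then have N: "c < ennreal (\<Sum>n<N. a n * \<rho> ^ Suc n)"
    using assms(1) by (simp only: part less_imp_le)
  have "((\<lambda>s. ennreal (\<Sum>n<N. a n * s ^ Suc n)) \<longlongrightarrow> ennreal (\<Sum>n<N. a n * \<rho> ^ Suc n)) (at_left \<rho>)"
    by (intro tendsto_ennrealI tendsto_intros)
  from order_tendstoD(1)[OF this N]
  have "eventually (\<lambda>s. c < ennreal (\<Sum>n<N. a n * s ^ Suc n)) (at_left \<rho>)" .
  moreover have "eventually (\<lambda>s. s \<in> {0<..<\<rho>}) (at_left \<rho>)"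
    using assms(1) by (rule eventually_at_left_real)
  ultimately have "eventually (\<lambda>s. 0 < s \<and> s < \<rho> \<and> c < f s) (at_left \<rho>)"
  proof eventually_elim
    case (elim s)
    have "(\<Sum>n<N. d (Suc n) * ennreal s ^ Suc n) \<le> f s"
      unfolding cmj_f_def by (intro sum_le_suminf) auto
    with elim part[of s N] show ?case by simp
  qed
  from eventually_happens'[OF _ this] that show ?thesis by auto
qed

text \<open>If \<open>s < t\<close>, then \<open>f_le_ratio\<close> would give
  \<open>1 \<le> s / t\<close>.\<close>

lemma f_solution_unique:
  assumes "0 < s" "ennreal m * f s = 1" "0 < t" "ennreal m * f t = 1"
  shows "s = t"
proof -
  have "\<not> s < t" if "0 < s" "0 < t" "ennreal m * f s = 1" "ennreal m * f t = 1" for s t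
  proof
    assume "s < t"
    then have "ennreal m * f s \<le> ennreal m * (ennreal (s / t) * f t)"
      using that by (intro mult_left_mono f_le_ratio) auto
    also have "\<dots> = ennreal (s / t)"
      by (subst mult.left_commute) (simp only: that mult_1_right)
    finally show False using that \<open>s < t\<close> by (simp add: field_simps)
  qed
  then show ?thesis using assms by (metis linorder_neqE)
qed

text \<open>Once a solution exists, \<open>f_solution_unique\<close> makes the definite description
  in \<open>malthusian\<close> well defined.\<close>

lemma malthusian_finite:
  assumes "malthusian H g m > -\<infinity>" and "\<exists>s>0. ennreal m * f s = 1"
  shows "ennreal m * f (exp (- real_of_ereal (malthusian H g m))) = 1"
proof -
  obtain s where s: "s > 0" "ennreal m * f s = 1" using assms(2) by blast
  define \<alpha> where "\<alpha> = (THE a. ennreal m * f (exp (- a)) = 1)"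
  have "\<exists>!a. ennreal m * f (exp (- a)) = 1"
  proof (rule ex1I[of _ "- ln s"])
    show "ennreal m * f (exp (- (- ln s))) = 1" using s by simp
    fix a assume "ennreal m * f (exp (- a)) = 1"
    then have "exp (- a) = s" using f_solution_unique s by simp
    then show "a = - ln s" by (metis add.inverse_inverse ln_exp)
  qed
  then have "ennreal m * f (exp (- \<alpha>)) = 1" unfolding \<alpha>_def by (rule theI')
  moreover have "malthusian H g m = ereal \<alpha>"
    using assms(1) by (auto simp: malthusian_def \<alpha>_def split: if_splits)
  ultimately show ?thesis by simp
qed

end

context irreducible_linear_fractional
begin

text \<open>\<open>f\<close> is finite everywhere, and unbounded by \<open>d 1 * s \<le> f s\<close>
  with \<open>d 1 > 0\<close>.\<close>

lemma cmj_Rf_infinite: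
  assumes "cmj_Rf H g = \<infinity>"
  shows "cmj_f_at_Rf H g = \<infinity>" "\<exists>s>0. ennreal m * f s = 1"
proof -
  have fin: "f s < \<infinity>" if "s > 0" for s
  proof (rule ccontr)
    assume "\<not> ?thesis"
    then have "f s = \<infinity>" by (simp flip: less_top)
    then have "ereal s \<ge> cmj_Rf H g" unfolding cmj_Rf_def using that by (intro Inf_lower) auto
    then show False using assms by simp
  qed
  have lower: "d 1 * ennreal s \<le> f s" for s
    using term_le_suminf_ennreal[of "\<lambda>n. d (Suc n) * ennreal s ^ Suc n" 0] by (simp add: cmj_f_def)
  have d1: "d 1 < \<infinity>" using d_le_1[of 1] by (simp add: le_less_trans)
  have "((\<lambda>s. ennreal s) \<longlongrightarrow> top) at_top"
    using filterlim_ident[of at_top] by (rule ennreal_tendsto_top_eq_at_top[THEN iffD2, rotated -1])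
  then have "((\<lambda>s. d 1 * ennreal s) \<longlongrightarrow> d 1 * top) at_top"
    using d1 by (intro ennreal_tendsto_cmult) simp_all
  then have lim: "((\<lambda>s. d 1 * ennreal s) \<longlongrightarrow> top) at_top"
    using d_pos[of 1] by (simp add: ennreal_mult_top zero_less_iff_neq_zero)
  have "(f \<longlongrightarrow> top) at_top"
    by (rule tendsto_sandwich[OF _ _ lim tendsto_const]) (use lower in auto)
  then show "cmj_f_at_Rf H g = \<infinity>"
    using assms by (simp add: cmj_f_at_Rf_def tendsto_Lim)
  \<comment> \<open>At this point the linear lower bound \<open>d 1 * t\<close> equals
    \<open>1 / m\<close>.\<close>
  define t where "t = 1 / (m * enn2real (d 1))"
  have dp: "enn2real (d 1) > 0" using d_pos[of 1] d1 by (simp add: enn2real_positive_iff)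
  then have t: "t > 0" using m_pos by (simp add: t_def)
  have "d 1 * ennreal t = ennreal (enn2real (d 1)) * ennreal t" using d1 by simp
  also have "\<dots> = ennreal (1 / m)" using m_pos dp by (simp add: t_def flip: ennreal_mult)
  finally have "f t \<ge> ennreal (1 / m)" using lower[of t] by simp
  then obtain s where "0 < s" "ennreal m * f s = 1"
    by (rule f_solution_exists[of t "2 * t", rotated 3]) (use t fin[of "2 * t"] in auto)
  then show "\<exists>s>0. ennreal m * f s = 1" by blast
qed

text \<open>By \<open>f_finite\<close> the infimum is at least 1, hence a positive real;
  monotonicity of \<open>f\<close> makes it a threshold.\<close>

lemma cmj_Rf_finite:
  assumes "cmj_Rf H g \<noteq> \<infinity>"
  obtains \<rho> where "cmj_Rf H g = ereal \<rho>" "\<rho> > 0" "cmj_f_at_Rf H g = f \<rho>"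
    "\<And>s. 0 < s \<Longrightarrow> s < \<rho> \<Longrightarrow> f s < \<infinity>" "\<And>s. \<rho> < s \<Longrightarrow> f s = \<infinity>"
proof -
  have "ereal 1 \<le> cmj_Rf H g"
    unfolding cmj_Rf_def
  proof (intro Inf_greatest, safe)
    fix s assume "0 < s" "f s = \<infinity>"
    then have "\<not> s < 1" using f_finite[of s] by auto
    then show "ereal 1 \<le> ereal s" by simp
  qed
  then obtain \<rho> where \<rho>: "cmj_Rf H g = ereal \<rho>" "\<rho> \<ge> 1"
    using assms by (cases "cmj_Rf H g") auto
  show ?thesis
  proof (rule that[OF \<rho>(1)])
    show "\<rho> > 0" using \<rho> by simp
    show "cmj_f_at_Rf H g = f \<rho>" using \<rho> by (simp add: cmj_f_at_Rf_def)
    fix s :: real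
    show "f s < \<infinity>" if "0 < s" "s < \<rho>"
    proof (rule ccontr)
      assume "\<not> ?thesis"
      then have "f s = \<infinity>" by (simp flip: less_top)
      then have "ereal s \<ge> cmj_Rf H g" unfolding cmj_Rf_def using that by (intro Inf_lower) auto
      then show False using \<rho> that by simp
    qed
    show "f s = \<infinity>" if "\<rho> < s"
    proof -
      have "cmj_Rf H g < ereal s" using that \<rho> by simp
      then obtain t where "0 < t" "f t = \<infinity>" "t < s"
        unfolding cmj_Rf_def by (auto simp: Inf_less_iff)
      then show ?thesis using f_mono[of t s] by (simp add: top_unique)
    qed
  qed
qed

text \<open>In both cases \<open>R\<close> is the threshold at which \<open>m * f s\<close> reaches 1, possibly by jumping
  from below 1 to \<open>\<infinity>\<close> right after \<open>R\<close>.\<close>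

lemma threshold:
  obtains R where "R > 0"
    "ereal R = (if malthusian H g m > -\<infinity> then ereal (exp (- real_of_ereal (malthusian H g m)))
                else cmj_Rf H g)"
    "malthusian H g m > -\<infinity> \<Longrightarrow> ennreal m * f R = 1"
    "\<not> malthusian H g m > -\<infinity> \<Longrightarrow> ennreal m * f R < 1"
    "\<And>s. 0 < s \<Longrightarrow> s < R \<Longrightarrow> ennreal m * f s < 1"
    "\<And>s. R < s \<Longrightarrow> 1 \<le> ennreal m * f s"
proof (cases "malthusian H g m > -\<infinity>")
  case True
  then have ge: "cmj_f_at_Rf H g \<ge> ennreal (1 / m)"
    by (auto simp: malthusian_def split: if_splits)
  have "\<exists>s>0. ennreal m * f s = 1"
  proof (cases "cmj_Rf H g = \<infinity>")
    case False
    then obtain \<rho> where \<rho>: "\<rho> > 0" "cmj_f_at_Rf H g = f \<rho>"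
      "\<And>s. 0 < s \<Longrightarrow> s < \<rho> \<Longrightarrow> f s < \<infinity>"
      using cmj_Rf_finite by metis
    show ?thesis
    proof (cases "f \<rho> = ennreal (1 / m)")
      case True
      then show ?thesis using \<rho>(1) mult_eq_1_iff by blast
    next
      case False
      then have "ennreal (1 / m) < f \<rho>" using ge \<rho>(2) by simp
      then obtain t where t: "0 < t" "t < \<rho>" "ennreal (1 / m) < f t"
        using f_left_continuous[OF \<rho>(1)] by blast
      \<comment> \<open>The midpoint serves as the point of finite value beyond \<open>t\<close>
        that \<open>f_solution_exists\<close> requires; \<open>f \<rho>\<close> itself may be
        infinite.\<close>
      have "f ((t + \<rho>) / 2) < \<infinity>" using t by (intro \<rho>(3)) auto
      with t obtain s where "0 < s" "ennreal m * f s = 1"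
        by (elim f_solution_exists[of t "(t + \<rho>) / 2", rotated 2]) auto
      then show ?thesis by blast
    qed
  qed (rule cmj_Rf_infinite)
  then have R: "ennreal m * f (exp (- real_of_ereal (malthusian H g m))) = 1" (is "_ * f ?R = 1")
    using malthusian_finite True by blast
  show ?thesis
  proof (rule that[of ?R])
    fix s assume s: "0 < s" "s < ?R"
    \<comment> \<open>The ratio bound supplies strictness through the factor
      \<open>s / ?R < 1\<close>.\<close>
    then have "ennreal m * f s \<le> ennreal m * (ennreal (s / ?R) * f ?R)"
      by (intro mult_left_mono f_le_ratio) auto
    also have "\<dots> = ennreal (s / ?R)"
      by (subst mult.left_commute) (simp only: R mult_1_right)
    also have "\<dots> < 1" using s by (simp add: ennreal_less_one_iff)
    finally show "ennreal m * f s < 1" .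
  next
    fix s assume "?R < s"
    then show "1 \<le> ennreal m * f s"
      using mult_left_mono[OF f_mono[of ?R s], of "ennreal m"] R by simp
  qed (use True R in auto)
next
  case False
  then have less: "cmj_f_at_Rf H g < ennreal (1 / m)"
    by (auto simp: malthusian_def split: if_splits)
  then have "cmj_Rf H g \<noteq> \<infinity>" using cmj_Rf_infinite(1) by auto
  then obtain \<rho> where \<rho>: "cmj_Rf H g = ereal \<rho>" "\<rho> > 0" "cmj_f_at_Rf H g = f \<rho>"
    "\<And>s. 0 < s \<Longrightarrow> s < \<rho> \<Longrightarrow> f s < \<infinity>" "\<And>s. \<rho> < s \<Longrightarrow> f s = \<infinity>"
    using cmj_Rf_finite by metis
  have "ennreal m * f \<rho> < 1" using less \<rho>(3) by (simp add: mult_less_1_iff)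
  moreover have "ennreal m * f s \<le> ennreal m * f \<rho>" if "s < \<rho>" for s
    using that by (intro mult_left_mono f_mono) auto
  ultimately show ?thesis
    using that[of \<rho>] \<rho> False m_pos by (auto simp: ennreal_mult_top intro: le_less_trans)
qed

text \<open>The row sums of \<open>M\<close> are at most \<open>1 + m\<close>, so those of its
  \<open>n\<close>-th power are at most \<open>(1 + m) ^ n\<close>. Finiteness makes
  \<open>enn2real\<close> lossless in the convergence parameter.\<close>

lemma mat_pow_M_finite: "mat_pow M n i j < \<infinity>"
proof -
  have ones: "mat_vec M ones k \<le> ennreal (1 + m) * ones k" for k
  proof -
    have "mat_vec M ones k = (1 + ennreal m) * h 1 k"
      by (simp add: mat_vec_mean_matrix dotp_g_ones distrib_right)
    also have "\<dots> \<le> (1 + ennreal m) * ones k" by (intro mult_left_mono h_le_ones) simp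
    finally show ?thesis using m_pos by (simp add: ennreal_plus)
  qed
  have "mat_vec (mat_pow M n) ones i \<le> ennreal (1 + m) ^ n" for i
  proof (induction n)
    case (Suc n)
    have "mat_vec (mat_pow M (Suc n)) ones i \<le> mat_vec (mat_pow M n) (\<lambda>k. ennreal (1 + m) * ones k) i"
      unfolding mat_pow.simps mat_vec_mult by (rule mat_vec_mono) (rule ones)
    also have "\<dots> \<le> ennreal (1 + m) * ennreal (1 + m) ^ n"
      unfolding mat_vec_cmult by (intro mult_left_mono Suc) simp
    finally show ?case by simp
  qed (simp add: ones_def)
  with entry_le_row_sum have "mat_pow M n i j \<le> ennreal (1 + m) ^ n" by (rule order_trans)
  then show ?thesis by (rule le_less_trans) (simp add: power_less_top_ennreal)
qed

section \<open>Positivity and finiteness of the generating functions\<close>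

lemma gen_h_pos:
  assumes "s > 0"
  shows "gen_h (ennreal s) i > 0"
proof -
  have "0 < ennreal s ^ Suc 0 * h (Suc 0) i"
    using assms h_pos[of "Suc 0" i] by (simp add: ennreal_zero_less_mult_iff)
  also have "\<dots> \<le> gen_h (ennreal s) i" unfolding gen_h_def by (rule term_le_suminf_ennreal)
  finally show ?thesis .
qed

lemma gen_b_pos:
  assumes "s > 0"
  shows "gen_b (ennreal s) j > 0"
proof -
  obtain k where "b k j > 0" using ex_b_pos by blast
  then have "0 < ennreal s ^ k * b k j"
    using assms by (simp add: ennreal_zero_less_mult_iff ennreal_power)
  also have "\<dots> \<le> gen_b (ennreal s) j" unfolding gen_b_def by (rule term_le_suminf_ennreal)
  finally show ?thesis .
qed

text \<open>Each entry of \<open>b k\<close> is at most the total mass \<open>d k\<close>, and these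
  masses, weighted by \<open>s ^ k\<close>, sum to \<open>1 + f s\<close>.\<close>

lemma gen_b_finite:
  assumes "f s < \<infinity>"
  shows "gen_b (ennreal s) j < \<infinity>"
proof -
  have "b k j \<le> d k" for k
    using term_le_dotp[of "b k" j ones] by (simp add: cmj_d_def ones_def)
  then have "gen_b (ennreal s) j \<le> (\<Sum>k. ennreal s ^ k * d k)"
    unfolding gen_b_def by (intro suminf_le mult_left_mono) auto
  also have "\<dots> = 1 + f s"
    by (subst suminf_Suc_ennreal) (simp add: d_0 cmj_f_def mult.commute)
  also have "\<dots> < \<infinity>" using assms by (simp add: less_top)
  finally show ?thesis .
qed

text \<open>Since type \<open>i\<close> is not phantom, \<open>h k i\<close> is bounded by a multiple of \<open>d (l + k)\<close>
  for a suitable \<open>l\<close>.\<close>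

lemma gen_h_finite:
  assumes s: "s > 0" and f: "f s < \<infinity>"
  shows "gen_h (ennreal s) i < \<infinity>"
proof -
  obtain l where l: "b l i > 0" using ex_b_pos by blast
  have "ennreal s ^ l * b l i * gen_h (ennreal s) i
      = (\<Sum>k. (b l i * h (Suc k) i) * ennreal s ^ (l + Suc k))"
    unfolding gen_h_def ennreal_suminf_cmult[symmetric] by (simp add: power_add ac_simps)
  also have "\<dots> \<le> (\<Sum>k. d (l + Suc k) * ennreal s ^ (l + Suc k))"
    unfolding dotp_b_h[symmetric] by (intro suminf_le mult_right_mono term_le_dotp) auto
  also have "\<dots> \<le> f s"
    using suminf_offset[of "\<lambda>n. d (Suc n) * ennreal s ^ Suc n" l]
    by (simp add: cmj_f_def add.commute)
  finally have "ennreal s ^ l * b l i * gen_h (ennreal s) i < \<infinity>" using f by simp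
  moreover have "ennreal s ^ l * b l i > 0"
    using s l by (simp add: ennreal_zero_less_mult_iff ennreal_power)
  ultimately have "gen_h (ennreal s) i \<noteq> top"
    by (metis ennreal_mult_top infinity_ennreal_def less_irrefl)
  then show ?thesis by (simp only: infinity_ennreal_def less_top)
qed

lemma suminf_mat_pow_H_finite:
  assumes "s > 0" "f s < \<infinity>"
  shows "(\<Sum>n. mat_pow H n i j * ennreal s ^ n) < \<infinity>"
proof -
  have "(\<Sum>n. mat_pow H n i j * ennreal s ^ n) \<le> (\<Sum>n. h n i * ennreal s ^ n)"
    by (intro suminf_le mult_right_mono entry_le_row_sum) auto
  also have "\<dots> = 1 + gen_h (ennreal s) i"
    by (subst suminf_Suc_ennreal) (simp add: gen_h_def ones_def mult.commute)
  also have "\<dots> < \<infinity>" using gen_h_finite[OF assms] by (simp add: less_top)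
  finally show ?thesis .
qed

text \<open>In \<open>suminf_mat_pow_M\<close> the factors beside \<open>gen_u\<close> are positive,
  so an infinite \<open>gen_u\<close> makes the series infinite; if \<open>m * f s < 1\<close>, all
  parts are finite.\<close>

lemma suminf_mat_pow_M_finite_iff:
  assumes "s > 0"
  shows "(\<Sum>n. mat_pow M n i j * ennreal s ^ n) < \<infinity> \<longleftrightarrow> ennreal m * f s < 1"
proof (cases "ennreal m * f s < 1")
  case True
  then have f: "f s < \<infinity>" using mult_less_1_iff[of "f s"] by (auto intro: less_trans[OF _ ennreal_less_top])
  show ?thesis
    unfolding suminf_mat_pow_M
    using True suminf_mat_pow_H_finite[OF assms f] gen_h_finite[OF assms f] gen_b_finite[OF f]
      gen_u_finite[OF True] by (simp add: ennreal_mult_less_top)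
next
  case False
  then have "gen_u (ennreal s) = \<infinity>" by (intro gen_u_infinite) (simp add: not_less)
  then show ?thesis
    unfolding suminf_mat_pow_M
    using False gen_h_pos[OF assms, of i] gen_b_pos[OF assms, of j] m_pos
    by (simp add: ennreal_mult_top ennreal_top_mult zero_less_iff_neq_zero)
qed

end

subsection \<open>Eigenvectors and the limit\<close>

context linear_fractional
begin

lemma dotp_g_gen_h: "dotp g (gen_h (ennreal s)) = f s"
  unfolding gen_h_def dotp_suminf_right dotp_cmult_right dotp_g_h cmj_f_def
  by (simp only: mult.commute)

lemma dotp_gen_b_h: "ennreal s * dotp (gen_b (ennreal s)) (h 1) = f s"
  unfolding gen_b_def dotp_suminf_left dotp_cmult_left dotp_b_h cmj_f_def
  by (simp add: mult.assoc mult.commute[of "d _"] flip: ennreal_suminf_cmult)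

lemma dotp_gen_b_ones: "dotp (gen_b (ennreal s)) ones = 1 + f s"
proof -
  have "dotp (gen_b (ennreal s)) ones = (\<Sum>k. ennreal s ^ k * d k)"
    unfolding gen_b_def dotp_suminf_left dotp_cmult_left cmj_d_def ..
  then show ?thesis
    by (subst (asm) suminf_Suc_ennreal) (simp add: d_0 cmj_f_def mult.commute)
qed

text \<open>The exponents \<open>k\<close> and \<open>Suc l\<close> add up to \<open>Suc n\<close>
  in \<open>Suc n\<close> ways. At the Malthusian point the result is the mean age divided by
  \<open>m\<close>.\<close>

lemma dotp_gen_b_gen_h:
  "dotp (gen_b s) (gen_h s) = (\<Sum>n. of_nat (Suc n) * (s ^ Suc n * d (Suc n)))"
proof -
  have "dotp (gen_b s) (gen_h s) = (\<Sum>k l. s ^ k * (s ^ Suc l * d (k + Suc l)))"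
    unfolding gen_b_def dotp_suminf_left dotp_cmult_left
    unfolding gen_h_def dotp_suminf_right dotp_cmult_right dotp_b_h by simp
  also have "\<dots> = (\<Sum>k l. s ^ Suc (k + l) * d (Suc (k + l)))"
    by (simp add: power_add ac_simps)
  finally show ?thesis by (simp only: suminf_antidiagonal_ennreal[of "\<lambda>n. s ^ Suc n * d (Suc n)"])
qed

text \<open>Applying \<open>R * H\<close> shifts the series and loses its first term
  \<open>R * h 1\<close>; the rank-one part restores it because \<open>m * f R = 1\<close>.\<close>

lemma gen_h_eigenvector:
  assumes "ennreal m * f R = 1"
  shows "ennreal R * mat_vec M (gen_h (ennreal R)) i = gen_h (ennreal R) i"
proof -
  have "mat_vec H (gen_h (ennreal R)) i = (\<Sum>k. ennreal R ^ Suc k * h (Suc (Suc k)) i)"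
    unfolding gen_h_def mat_vec_suminf mat_vec_cmult mat_vec_h ..
  moreover have "ennreal m * mat_vec H ones i * f R = h (Suc 0) i"
    using assms by (simp add: ac_simps) (metis mult.assoc mult.commute mult_1)
  moreover have "gen_h (ennreal R) i = ennreal R * h (Suc 0) i
      + (\<Sum>k. ennreal R ^ Suc (Suc k) * h (Suc (Suc k)) i)"
    unfolding gen_h_def by (subst suminf_Suc_ennreal) simp
  ultimately show ?thesis
    unfolding mat_vec_mean_matrix dotp_g_gen_h
    by (simp add: distrib_left add.commute mult.assoc flip: ennreal_suminf_cmult)
qed

text \<open>As for \<open>gen_h\<close>, with \<open>g\<close> as the lost first term;
  \<open>dotp_gen_b_h\<close> evaluates the rank-one part.\<close>

lemma gen_b_eigenvector:
  assumes "ennreal m * f R = 1"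
  shows "ennreal R * vec_mat (gen_b (ennreal R)) M j = gen_b (ennreal R) j"
proof -
  have "vec_mat (gen_b (ennreal R)) H j = (\<Sum>k. ennreal R ^ k * b (Suc k) j)"
    unfolding gen_b_def vec_mat_suminf vec_mat_cmult vec_mat_b ..
  moreover have "gen_b (ennreal R) j = g j + (\<Sum>k. ennreal R ^ Suc k * b (Suc k) j)"
    unfolding gen_b_def by (subst suminf_Suc_ennreal) simp
  moreover have "ennreal R * (ennreal m * dotp (gen_b (ennreal R)) (mat_vec H ones) * g j) = g j"
  proof -
    have "ennreal R * (ennreal m * dotp (gen_b (ennreal R)) (mat_vec H ones) * g j)
        = ennreal m * (ennreal R * dotp (gen_b (ennreal R)) (h 1)) * g j"
      by (simp add: ac_simps)
    then show ?thesis unfolding dotp_gen_b_h assms by simp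
  qed
  ultimately show ?thesis
    unfolding vec_mat_mean_matrix
    by (simp add: distrib_left add.commute mult.assoc flip: ennreal_suminf_cmult)
qed

text \<open>The eigenvector equation reads \<open>x = R * H x + R * c * h 1\<close>. Iterating it
  from 0 produces the partial sums of \<open>c * gen_h\<close>, which therefore stay below
  \<open>x\<close>.\<close>

lemma eigenvector_ge_gen_h:
  assumes x: "\<And>i. ennreal R * mat_vec M x i = x i"
  shows "ennreal m * dotp g x * gen_h (ennreal R) i \<le> x i"
proof -
  define c where "c = ennreal m * dotp g x"
  have x_eq: "x i = ennreal R * mat_vec H x i + ennreal R * (c * h (Suc 0) i)" for i
    by (subst x[symmetric]) (simp add: mat_vec_mean_matrix c_def distrib_left ac_simps)
  have "(\<Sum>k<N. c * (ennreal R ^ Suc k * h (Suc k) i)) \<le> x i" for N i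
  proof (induction N arbitrary: i)
    case (Suc N)
    have "(\<Sum>k<Suc N. c * (ennreal R ^ Suc k * h (Suc k) i))
        = ennreal R * (\<Sum>k<N. c * (ennreal R ^ Suc k * h (Suc (Suc k)) i)) + ennreal R * (c * h (Suc 0) i)"
      by (simp add: sum.lessThan_Suc_shift sum_distrib_left ac_simps del: sum.lessThan_Suc)
    also have "(\<Sum>k<N. c * (ennreal R ^ Suc k * h (Suc (Suc k)) i))
        = mat_vec H (\<lambda>i. \<Sum>k<N. c * (ennreal R ^ Suc k * h (Suc k) i)) i"
      by (simp only: mat_vec_sum mat_vec_cmult mat_vec_h)
    also have "\<dots> \<le> mat_vec H x i" by (rule mat_vec_mono) (rule Suc)
    finally show ?case unfolding x_eq[of i] by (simp add: mult_left_mono)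
  qed simp
  then have "(\<Sum>k. c * (ennreal R ^ Suc k * h (Suc k) i)) \<le> x i"
    by (intro suminf_le_const) auto
  then show ?thesis by (simp add: gen_h_def c_def)
qed

text \<open>The left counterpart, where the iteration has the source term
  \<open>c * g\<close>.\<close>

lemma eigenvector_ge_gen_b:
  assumes y: "\<And>j. ennreal R * vec_mat y M j = y j"
  shows "ennreal R * ennreal m * dotp y (h 1) * gen_b (ennreal R) j \<le> y j"
proof -
  define c where "c = ennreal R * ennreal m * dotp y (h 1)"
  have y_eq: "y j = ennreal R * vec_mat y H j + c * g j" for j
    by (subst y[symmetric]) (simp add: vec_mat_mean_matrix c_def distrib_left ac_simps)
  have "(\<Sum>k<N. c * (ennreal R ^ k * b k j)) \<le> y j" for N j
  proof (induction N arbitrary: j)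
    case (Suc N)
    have "(\<Sum>k<Suc N. c * (ennreal R ^ k * b k j))
        = ennreal R * (\<Sum>k<N. c * (ennreal R ^ k * b (Suc k) j)) + c * g j"
      by (simp add: sum.lessThan_Suc_shift sum_distrib_left ac_simps del: sum.lessThan_Suc)
    also have "(\<Sum>k<N. c * (ennreal R ^ k * b (Suc k) j))
        = vec_mat (\<lambda>j. \<Sum>k<N. c * (ennreal R ^ k * b k j)) H j"
      by (simp only: vec_mat_sum vec_mat_cmult vec_mat_b)
    also have "\<dots> \<le> vec_mat y H j" by (rule vec_mat_mono) (rule Suc)
    finally show ?case unfolding y_eq[of j] by (simp add: mult_left_mono)
  qed simp
  then have "(\<Sum>k. c * (ennreal R ^ k * b k j)) \<le> y j"
    by (intro suminf_le_const) auto
  then show ?thesis by (simp add: gen_b_def c_def)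
qed

lemma mean_age_eq:
  assumes "malthusian H g m > -\<infinity>" "R = exp (- real_of_ereal (malthusian H g m))"
  shows "mean_age H g m = ennreal m * dotp (gen_b (ennreal R)) (gen_h (ennreal R))"
proof -
  have "exp (- real_of_ereal (malthusian H g m) * real (Suc n)) = R ^ Suc n" for n
    unfolding assms(2) by (metis exp_of_nat2_mult)
  then have "ennreal (exp (- real_of_ereal (malthusian H g m) * real (Suc n))) = ennreal R ^ Suc n" for n
    using assms(2) by (simp only: ennreal_power exp_ge_zero)
  then show ?thesis
    using assms(1) unfolding mean_age_def dotp_gen_b_gen_h
    by (simp only: if_True mult.assoc mult.commute[of "d _"])
qed

lemma lim_u_eq: "lim_u H g m R i = ennreal (1 + m) * inverse (mean_age H g m) * gen_h (ennreal R) i"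
  by (simp add: lim_u_def gen_h_def)

lemma lim_v_eq: "lim_v H g m R j = ennreal (m / (1 + m)) * gen_b (ennreal R) j"
  by (simp add: lim_v_def gen_b_def)

end

section \<open>Recurrence criteria and the limit theorem\<close>

context irreducible_linear_fractional
begin

lemma R_recurrent_iff:
  assumes "R > 0"
  shows "R_recurrent R M \<longleftrightarrow> 1 \<le> ennreal m * f R"
proof -
  have "(\<Sum>n. mat_pow M n i i * ennreal R ^ n) = \<infinity> \<longleftrightarrow> 1 \<le> ennreal m * f R" for i
    using suminf_mat_pow_M_finite_iff[OF assms, of i i]
    by (metis infinity_ennreal_def less_top not_le)
  then show ?thesis by (simp only: R_recurrent_def) simp
qed

text \<open>\<open>gen_h\<close> and \<open>gen_b\<close> are themselves admissible eigenvectors.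
  Conversely, any admissible pair dominates positive multiples of them, so finiteness of its product
  carries over.\<close>

lemma R_positively_recurrent_iff:
  assumes R: "R > 0" and f: "ennreal m * f R = 1"
  shows "R_positively_recurrent R M \<longleftrightarrow> dotp (gen_b (ennreal R)) (gen_h (ennreal R)) < \<infinity>"
proof
  have f_fin: "f R < \<infinity>" using f by (simp add: mult_eq_1_iff)
  assume "dotp (gen_b (ennreal R)) (gen_h (ennreal R)) < \<infinity>"
  then show "R_positively_recurrent R M"
    unfolding R_positively_recurrent_def positive_vec_def
    using R_recurrent_iff[OF R] f gen_h_eigenvector[OF f] gen_b_eigenvector[OF f]
      gen_h_pos[OF R] gen_b_pos[OF R] gen_h_finite[OF R f_fin] gen_b_finite[OF f_fin]
    by (intro conjI exI[of _ "gen_h (ennreal R)"] exI[of _ "gen_b (ennreal R)"]) simp_all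
next
  assume "R_positively_recurrent R M"
  then obtain x y where x: "positive_vec x" "\<And>i. ennreal R * mat_vec M x i = x i"
    and y: "positive_vec y" "\<And>j. ennreal R * vec_mat y M j = y j" and yx: "dotp y x < \<infinity>"
    unfolding R_positively_recurrent_def by blast
  define c1 c2 where "c1 = ennreal m * dotp g x" and "c2 = ennreal R * ennreal m * dotp y (h 1)"
  obtain k where "g k > 0" using ex_g_pos by blast
  then have "0 < g k * x k" using x(1) by (simp add: positive_vec_def ennreal_zero_less_mult_iff)
  then have "dotp g x > 0" using term_le_dotp[of g k x] by (rule less_le_trans)
  then have c1: "c1 > 0" using m_pos by (simp add: c1_def ennreal_zero_less_mult_iff)
  have "0 < y 0 * h 1 0"
    using y(1) h_pos[of 1 0] by (simp add: positive_vec_def ennreal_zero_less_mult_iff)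
  then have "dotp y (h 1) > 0" using term_le_dotp[of y 0 "h 1"] by (rule less_le_trans)
  then have c2: "c2 > 0" using m_pos R by (simp add: c2_def ennreal_zero_less_mult_iff)
  have "c2 * (c1 * dotp (gen_b (ennreal R)) (gen_h (ennreal R)))
      = dotp (\<lambda>j. c2 * gen_b (ennreal R) j) (\<lambda>i. c1 * gen_h (ennreal R) i)"
    by (simp only: dotp_cmult_left) (simp only: dotp_cmult_right)
  also have "\<dots> \<le> dotp y x"
    unfolding c1_def c2_def
    by (intro dotp_mono eigenvector_ge_gen_h eigenvector_ge_gen_b x y)
  finally have "c2 * (c1 * dotp (gen_b (ennreal R)) (gen_h (ennreal R))) \<le> dotp y x" .
  then have "c2 * (c1 * dotp (gen_b (ennreal R)) (gen_h (ennreal R))) < \<infinity>"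
    using yx by (rule le_less_trans)
  \<comment> \<open>Both constants are nonzero, so an infinite product would stay infinite after
    scaling.\<close>
  then have "dotp (gen_b (ennreal R)) (gen_h (ennreal R)) \<noteq> top"
    using c1 c2 by (metis ennreal_mult_top infinity_ennreal_def less_irrefl)
  then show "dotp (gen_b (ennreal R)) (gen_h (ennreal R)) < \<infinity>"
    by (simp only: infinity_ennreal_def less_top)
qed

text \<open>\<open>gen_b\<close> dominates its term \<open>g\<close>, and \<open>g\<close> paired
  with \<open>gen_h\<close> gives \<open>f R\<close>. The bound keeps \<open>inverse \<beta>\<close>
  finite in the limit.\<close>

lemma mean_ge_1:
  assumes f: "ennreal m * f R = 1"
  shows "1 \<le> ennreal m * dotp (gen_b (ennreal R)) (gen_h (ennreal R))"
proof -
  have "f R \<le> dotp (gen_b (ennreal R)) (gen_h (ennreal R))"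
    unfolding dotp_g_gen_h[symmetric]
  proof (rule dotp_mono)
    show "g i \<le> gen_b (ennreal R) i" for i
      unfolding gen_b_def
      using term_le_suminf_ennreal[of "\<lambda>k. ennreal R ^ k * b k i" 0] by simp
  qed simp
  from mult_left_mono[OF this, of "ennreal m"] show ?thesis by (simp add: f)
qed

text \<open>Apart from a vanishing power of \<open>H\<close>, the scaled power of \<open>M\<close>
  is a double convolution of the summable terms of \<open>gen_h\<close> and \<open>gen_b\<close>
  with the scaled renewal sequence \<open>U\<close>, which tends to
  \<open>inverse \<beta>\<close>.\<close>

lemma scaled_mat_pow_M_tendsto:
  assumes R: "R > 0" and f: "ennreal m * f R = 1"
    and \<beta>: "ennreal m * dotp (gen_b (ennreal R)) (gen_h (ennreal R)) = \<beta>" "\<beta> < \<infinity>"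
  shows "(\<lambda>n. ennreal R ^ n * mat_pow M n i j) \<longlonglongrightarrow>
    ennreal m * (gen_h (ennreal R) i * (gen_b (ennreal R) j * inverse \<beta>))"
proof -
  let ?R = "ennreal R"
  \<comment> \<open>The value at 0 is set to 0, since \<open>d 0 = 1\<close> is not a renewal
    weight.\<close>
  define p where "p k = (if k = 0 then 0 else ennreal m * d k * ?R ^ k)" for k
  define U where "U n = u n * ?R ^ n" for n
  have f_fin: "f R < \<infinity>" using f by (simp add: mult_eq_1_iff)
  have p_sum: "(\<Sum>k. p k) = 1"
    by (subst suminf_Suc_ennreal)
      (simp add: p_def f[symmetric] cmj_f_def mult.assoc flip: ennreal_suminf_cmult del: power_Suc)
  have p_gcd: "Gcd {k. p k > 0} = 1"
  proof -
    have "p 1 > 0" using d_pos[of 1] R m_pos by (simp add: p_def ennreal_zero_less_mult_iff)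
    then show ?thesis by (metis Gcd_dvd is_unit_gcd_iff mem_Collect_eq nat_dvd_1_iff_1)
  qed
  have U_rec: "U n = (\<Sum>k\<le>n. p k * U (n - k))" if n_ge: "n \<ge> 1" for n
  proof -
    obtain n' where n: "n = Suc n'" using n_ge by (cases n) auto
    have "ennreal m * d (Suc k) * u (n' - k) * ?R ^ Suc n' = p (Suc k) * U (n' - k)" if "k \<le> n'" for k
    proof -
      have "?R ^ Suc n' = ?R ^ Suc k * ?R ^ (n' - k)" using that by (simp flip: power_add del: power_Suc)
      then show ?thesis by (simp add: p_def U_def ac_simps)
    qed
    then have "U (Suc n') = (\<Sum>k\<le>n'. p (Suc k) * U (n' - k))"
      by (simp add: U_def renewal_Suc sum_distrib_right del: power_Suc)
    then show ?thesis by (simp add: n sum.atMost_Suc_shift p_def del: sum.atMost_Suc)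
  qed
  have mean: "(\<Sum>k. of_nat k * p k) = \<beta>"
    unfolding \<beta>(1)[symmetric] dotp_gen_b_gen_h
    by (subst suminf_Suc_ennreal) (simp add: p_def ac_simps flip: ennreal_suminf_cmult)
  note renewal = renewal_theorem_ennreal[of p U \<beta>, OF p_sum _ p_gcd U_rec _ mean \<beta>(2)]
  have U_lim: "U \<longlonglongrightarrow> inverse \<beta>" and U_fin: "U n < \<infinity>" for n
    using renewal by (simp_all add: p_def U_def)
  have \<beta>_inv: "inverse \<beta> < \<infinity>"
    using mean_ge_1[OF f] \<beta>(1) by (auto simp: less_top[symmetric] ennreal_inverse_eq_top_iff)
  have b_fin: "gen_b ?R j < \<infinity>" using gen_b_finite[OF f_fin] .
  have W: "?R ^ n * w n j = (\<Sum>k\<le>n. (?R ^ k * b k j) * U (n - k))" for n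
  proof -
    have "?R ^ n * (b k j * u (n - k)) = (?R ^ k * b k j) * U (n - k)" if "k \<le> n" for k
    proof -
      have "?R ^ n = ?R ^ k * ?R ^ (n - k)" using that by (simp flip: power_add)
      then show ?thesis by (simp add: U_def ac_simps)
    qed
    then show ?thesis by (simp add: w_eq sum_distrib_left)
  qed
  have W_lim: "(\<lambda>n. ?R ^ n * w n j) \<longlonglongrightarrow> gen_b ?R j * inverse \<beta>"
    unfolding W gen_b_def
    by (rule tendsto_convolution_ennreal[OF _ U_lim \<beta>_inv U_fin]) (use b_fin in \<open>simp add: gen_b_def\<close>)
  have W_fin: "?R ^ n * w n j < \<infinity>" for n
  proof -
    have "?R ^ k * b k j < \<infinity>" for k
      using b_fin unfolding gen_b_def by (rule ennreal_suminf_lessD)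
    then show ?thesis using U_fin unfolding W by (simp add: ennreal_mult_less_top)
  qed
  have conv: "(\<lambda>n. \<Sum>k\<le>n. (?R ^ Suc k * h (Suc k) i) * (?R ^ (n - k) * w (n - k) j)) \<longlonglongrightarrow>
      gen_h ?R i * (gen_b ?R j * inverse \<beta>)"
    unfolding gen_h_def
    by (rule tendsto_convolution_ennreal[OF _ W_lim _ W_fin])
      (use gen_h_finite[OF R f_fin, of i] b_fin \<beta>_inv in \<open>simp_all add: gen_h_def ennreal_mult_less_top\<close>)
  have "(\<lambda>n. mat_pow H n i j * ?R ^ n) \<longlonglongrightarrow> 0"
    using suminf_mat_pow_H_finite[OF R f_fin] by (rule suminf_lt_top_imp_tendsto_0_ennreal)
  then have "(\<lambda>n. mat_pow H (Suc n) i j * ?R ^ Suc n) \<longlonglongrightarrow> 0" by (rule LIMSEQ_Suc)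
  from tendsto_add[OF this ennreal_tendsto_cmult[OF _ conv, of "ennreal m"]]
  have lim: "(\<lambda>n. mat_pow H (Suc n) i j * ?R ^ Suc n +
      ennreal m * (\<Sum>k\<le>n. (?R ^ Suc k * h (Suc k) i) * (?R ^ (n - k) * w (n - k) j))) \<longlonglongrightarrow>
      ennreal m * (gen_h ?R i * (gen_b ?R j * inverse \<beta>))"
    by simp
  \<comment> \<open>At \<open>Suc n\<close> the sum over \<open>k < Suc n\<close> in
    \<open>mat_pow_M\<close> becomes one over \<open>k \<le> n\<close>, the shape of
    \<open>conv\<close>.\<close>
  have "?R ^ Suc n * mat_pow M (Suc n) i j = mat_pow H (Suc n) i j * ?R ^ Suc n +
      ennreal m * (\<Sum>k\<le>n. (?R ^ Suc k * h (Suc k) i) * (?R ^ (n - k) * w (n - k) j))" for n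
  proof -
    have "?R ^ Suc n * (h (Suc k) i * w (n - k) j) = (?R ^ Suc k * h (Suc k) i) * (?R ^ (n - k) * w (n - k) j)"
      if "k \<le> n" for k
    proof -
      have "?R ^ Suc n = ?R ^ Suc k * ?R ^ (n - k)" using that by (simp flip: power_add del: power_Suc)
      then show ?thesis by (simp add: ac_simps)
    qed
    then have "?R ^ Suc n * (\<Sum>k\<le>n. h (Suc k) i * w (n - k) j)
        = (\<Sum>k\<le>n. (?R ^ Suc k * h (Suc k) i) * (?R ^ (n - k) * w (n - k) j))"
      by (simp add: sum_distrib_left del: power_Suc)
    then show ?thesis
      by (subst mat_pow_M)
        (simp only: diff_Suc_Suc lessThan_Suc_atMost distrib_left
          mult.left_commute[of "?R ^ Suc n" "ennreal m"] mult.commute[of "?R ^ Suc n" "mat_pow H _ _ _"])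
  qed
  with lim have "(\<lambda>n. ?R ^ Suc n * mat_pow M (Suc n) i j) \<longlonglongrightarrow>
      ennreal m * (gen_h ?R i * (gen_b ?R j * inverse \<beta>))"
    by (simp only:)
  then show ?thesis by (rule LIMSEQ_imp_Suc)
qed

text \<open>The normalisations rest on three values: \<open>gen_b\<close> paired with
  \<open>gen_h\<close> gives the mean age over \<open>m\<close>, \<open>gen_b\<close> paired with
  \<open>ones\<close> gives \<open>1 + 1 / m\<close>, and \<open>g\<close> paired with
  \<open>gen_h\<close> gives \<open>1 / m\<close>.\<close>

lemma limit_vectors:
  assumes R: "R > 0" and f: "ennreal m * f R = 1"
    and \<beta>: "mean_age H g m = ennreal m * dotp (gen_b (ennreal R)) (gen_h (ennreal R))"
    and fin: "mean_age H g m < \<infinity>"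
  shows "(\<lambda>n. ennreal R ^ n * mat_pow M n i j) \<longlonglongrightarrow> lim_u H g m R i * lim_v H g m R j"
    and "positive_vec (lim_u H g m R)"
    and "positive_vec (lim_v H g m R)"
    and "dotp (lim_v H g m R) (lim_u H g m R) = 1"
    and "dotp (lim_v H g m R) ones = 1"
    and "dotp g (lim_u H g m R) = ennreal (1 + m) / (ennreal m * mean_age H g m)"
proof -
  have f_fin: "f R < \<infinity>" using f by (simp add: mult_eq_1_iff)
  have "1 \<le> mean_age H g m" using mean_ge_1[OF f] \<beta> by simp
  with fin obtain r where r: "mean_age H g m = ennreal r" "r \<ge> 1"
    by (cases "mean_age H g m") auto
  then have inv: "inverse (mean_age H g m) = ennreal (1 / r)"
    by (simp add: inverse_ennreal inverse_eq_divide)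
  have u_eq: "lim_u H g m R = (\<lambda>i. ennreal ((1 + m) / r) * gen_h (ennreal R) i)"
    using m_pos r(2) ennreal_mult[of "1 + m" "1 / r"]
    by (simp only: fun_eq_iff lim_u_eq inv) simp
  have v_eq: "lim_v H g m R = (\<lambda>j. ennreal (m / (1 + m)) * gen_b (ennreal R) j)"
    by (simp add: fun_eq_iff lim_v_eq)
  \<comment> \<open>The constants of the two limit vectors multiply to \<open>m\<close> over the
    mean age, the constant in \<open>scaled_mat_pow_M_tendsto\<close>.\<close>
  have prod: "ennreal ((1 + m) / r) * ennreal (m / (1 + m)) = ennreal m * ennreal (1 / r)"
    using m_pos r(2) by (simp flip: ennreal_mult)
  have f_eq: "f R = ennreal (1 / m)" using f by (simp add: mult_eq_1_iff)
  show "(\<lambda>n. ennreal R ^ n * mat_pow M n i j) \<longlonglongrightarrow> lim_u H g m R i * lim_v H g m R j"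
  proof -
    have "lim_u H g m R i * lim_v H g m R j
        = (ennreal ((1 + m) / r) * ennreal (m / (1 + m))) * (gen_h (ennreal R) i * gen_b (ennreal R) j)"
      unfolding u_eq v_eq by (simp only: ac_simps)
    also have "\<dots> = ennreal m * (gen_h (ennreal R) i * (gen_b (ennreal R) j * inverse (mean_age H g m)))"
      unfolding prod inv by (simp only: ac_simps)
    finally show ?thesis using scaled_mat_pow_M_tendsto[OF R f \<beta>[symmetric] fin] by simp
  qed
  show "positive_vec (lim_u H g m R)"
    unfolding u_eq positive_vec_def
    using gen_h_pos[OF R] gen_h_finite[OF R f_fin] m_pos r(2)
    by (simp add: ennreal_zero_less_mult_iff ennreal_mult_less_top)
  show "positive_vec (lim_v H g m R)"
    unfolding v_eq positive_vec_def
    using gen_b_pos[OF R] gen_b_finite[OF f_fin] m_pos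
    by (simp add: ennreal_zero_less_mult_iff ennreal_mult_less_top)
  show "dotp (lim_v H g m R) (lim_u H g m R) = 1"
  proof -
    have "dotp (lim_v H g m R) (lim_u H g m R)
        = (ennreal ((1 + m) / r) * ennreal (m / (1 + m))) * dotp (gen_b (ennreal R)) (gen_h (ennreal R))"
      unfolding u_eq v_eq dotp_cmult_left dotp_cmult_right by (simp only: ac_simps)
    also have "\<dots> = ennreal (1 / r) * mean_age H g m"
      unfolding prod \<beta> by (simp only: ac_simps)
    also have "\<dots> = 1" using r by (simp flip: ennreal_mult)
    finally show ?thesis .
  qed
  show "dotp (lim_v H g m R) ones = 1"
    unfolding v_eq dotp_cmult_left dotp_gen_b_ones f_eq using m_pos add_pos_pos[of m "m * m"]
    by (simp add: field_simps flip: ennreal_mult ennreal_1 ennreal_plus)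
  show "dotp g (lim_u H g m R) = ennreal (1 + m) / (ennreal m * mean_age H g m)"
  proof -
    have "ennreal ((1 + m) / r) * ennreal (1 / m) = ennreal ((1 + m) / (m * r))"
      using m_pos r(2) by (simp add: mult.commute flip: ennreal_mult)
    also have "\<dots> = ennreal (1 + m) / (ennreal m * ennreal r)"
      using m_pos r(2) divide_ennreal[of "1 + m" "m * r"] ennreal_mult[of m r] by simp
    finally show ?thesis unfolding u_eq dotp_cmult_right dotp_g_gen_h f_eq r(1) .
  qed
qed

end

theorem theorem8:
  fixes H M :: nnmat and g :: nnvec and m :: real
  assumes "sub_stochastic H" and "prob_vec g" and "m > 0"
    and "M = mean_matrix H g m"
  shows "(mat_irreducible M \<longleftrightarrow>
            (\<forall>j. \<not> phantom_type H g j) \<and> (\<forall>i. \<not> zero_row H i)) \<and>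
    (mat_irreducible M \<and> mat_aperiodic M \<longrightarrow>
      (\<exists>R::real.
        is_convergence_parameter M R \<and>
        ereal R = (if malthusian H g m > -\<infinity>
                   then ereal (exp (- real_of_ereal (malthusian H g m)))
                   else cmj_Rf H g) \<and>
        (R_recurrent R M \<longleftrightarrow> malthusian H g m > -\<infinity>) \<and>
        (R_positively_recurrent R M \<longleftrightarrow> mean_age H g m < \<infinity>) \<and>
        (mean_age H g m < \<infinity> \<longrightarrow>
          (\<forall>i j. (\<lambda>n. ennreal R ^ n * mat_pow M n i j)
             \<longlonglongrightarrow> lim_u H g m R i * lim_v H g m R j) \<and>
          positive_vec (lim_u H g m R) \<and>
          positive_vec (lim_v H g m R) \<and>
          dotp (lim_v H g m R) (lim_u H g m R) = 1 \<and>
          dotp (lim_v H g m R) ones = 1 \<and>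
          dotp g (lim_u H g m R) = ennreal (1 + m) / (ennreal m * mean_age H g m))))"
proof -
  interpret linear_fractional H g m using assms(1-3) by unfold_locales
  show ?thesis
    unfolding assms(4)
  proof (intro conjI impI)
    show "mat_irreducible (mean_matrix H g m) \<longleftrightarrow>
        (\<forall>j. \<not> phantom_type H g j) \<and> (\<forall>i. \<not> zero_row H i)"
      by (rule irreducible_iff)
    assume "mat_irreducible (mean_matrix H g m) \<and> mat_aperiodic (mean_matrix H g m)"
    then interpret irreducible_linear_fractional H g m
      using irreducible_iff by unfold_locales auto
    obtain R where R: "R > 0"
      and R_eq: "ereal R = (if malthusian H g m > -\<infinity>
          then ereal (exp (- real_of_ereal (malthusian H g m))) else cmj_Rf H g)"
      and finite: "malthusian H g m > -\<infinity> \<Longrightarrow> ennreal m * cmj_f H g R = 1"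
      and infinite: "\<not> malthusian H g m > -\<infinity> \<Longrightarrow> ennreal m * cmj_f H g R < 1"
      and below: "\<And>s. 0 < s \<Longrightarrow> s < R \<Longrightarrow> ennreal m * cmj_f H g s < 1"
      and above: "\<And>s. R < s \<Longrightarrow> 1 \<le> ennreal m * cmj_f H g s"
      by (rule threshold) blast
    have "is_convergence_parameter (mean_matrix H g m) R"
      unfolding is_convergence_parameter_def
    proof (intro allI conv_radius_ennreal)
      fix i j s
      show "(\<Sum>n. mat_pow (mean_matrix H g m) n i j * ennreal s ^ n) < \<infinity>" if "0 < s" "s < R"
        using suminf_mat_pow_M_finite_iff[OF that(1)] below[OF that] by blast
      show "(\<Sum>n. mat_pow (mean_matrix H g m) n i j * ennreal s ^ n) = \<infinity>" if "R < s"
      proof -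
        have "\<not> (\<Sum>n. mat_pow (mean_matrix H g m) n i j * ennreal s ^ n) < \<infinity>"
          using above[OF that] R that by (subst suminf_mat_pow_M_finite_iff) (auto simp: not_less)
        then show ?thesis by (simp only: infinity_ennreal_def less_top[symmetric] not_not)
      qed
    qed (use R mat_pow_M_finite in auto)
    moreover have recurrent: "R_recurrent R (mean_matrix H g m) \<longleftrightarrow> malthusian H g m > -\<infinity>"
      using R_recurrent_iff[OF R] finite infinite by (metis not_le order_refl)
    moreover have mean: "mean_age H g m = ennreal m * dotp (gen_b (ennreal R)) (gen_h (ennreal R))"
      if "malthusian H g m > -\<infinity>"
      using mean_age_eq[OF that] R_eq that by simp
    have "R_positively_recurrent R (mean_matrix H g m) \<longleftrightarrow> mean_age H g m < \<infinity>"
    proof (cases "malthusian H g m > -\<infinity>")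
      case True
      then show ?thesis
        using R_positively_recurrent_iff[OF R finite] mean m_pos
        by (auto simp: ennreal_mult_less_top)
    next
      case False
      \<comment> \<open>Here the mean age is infinite by definition and \<open>M\<close> is not
        recurrent, so both sides fail.\<close>
      then show ?thesis using recurrent by (simp add: R_positively_recurrent_def mean_age_def)
    qed
    \<comment> \<open>A finite mean age excludes the value \<open>-\<infinity>\<close>, so
      \<open>m * f R = 1\<close> is available for \<open>limit_vectors\<close>.\<close>
    moreover have "malthusian H g m > -\<infinity>" if "mean_age H g m < \<infinity>"
      using that by (auto simp: mean_age_def split: if_splits)
    ultimately show "\<exists>R::real.
        is_convergence_parameter (mean_matrix H g m) R \<and>
        ereal R = (if malthusian H g m > -\<infinity>
                   then ereal (exp (- real_of_ereal (malthusian H g m)))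
                   else cmj_Rf H g) \<and>
        (R_recurrent R (mean_matrix H g m) \<longleftrightarrow> malthusian H g m > -\<infinity>) \<and>
        (R_positively_recurrent R (mean_matrix H g m) \<longleftrightarrow> mean_age H g m < \<infinity>) \<and>
        (mean_age H g m < \<infinity> \<longrightarrow>
          (\<forall>i j. (\<lambda>n. ennreal R ^ n * mat_pow (mean_matrix H g m) n i j)
             \<longlonglongrightarrow> lim_u H g m R i * lim_v H g m R j) \<and>
          positive_vec (lim_u H g m R) \<and>
          positive_vec (lim_v H g m R) \<and>
          dotp (lim_v H g m R) (lim_u H g m R) = 1 \<and>
          dotp (lim_v H g m R) ones = 1 \<and>
          dotp g (lim_u H g m R) = ennreal (1 + m) / (ennreal m * mean_age H g m))"
      using R_eq limit_vectors[OF R finite mean] by (intro exI[of _ R]) blast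
  qed
qed

end
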